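(* Let $n$ be a positive integer, $i\in\{2,\dots,n\}$, $k\in\{1,\dots,n-i\}$ and $j\in\{1,\dots,i-1\}$. Let $s_is_{i+1}\cdots s_{i+k}\,s_{i-j}s_{i-j+1}\cdots s_i\cdots s_{i+k-1}$ be a reduced expression for $w\in W(A_n)$ and let $s_is_{i+1}\cdots s_{i+k}$ be a reduced expression for $x\in W(A_n)$. Then $$a_{x,w}(q)=(-q)^k(1-q)^j.$$
   Context: $W(A_n)$ is the Coxeter group of type $A_n$ with generators $S(A_n)=\{s_1,\dots,s_n\}$ numbered along the graph ($s_as_{a+1}$ has order 3, and $s_a,s_b$ commute if $|a-b|>1$), so $W(A_n)\cong S_{n+1}$. In the expression for $w$, the factor $s_{i-j}s_{i-j+1}\cdots s_i\cdots s_{i+k-1}$ is the product of the generators with consecutive increasing indices from $i-j$ to $i+k-1$. Write $X=A_n$. Let $\ell$ be the length function, $\le$ the Bruhat order, $e$ the identity of $W(X)$, and $\mathcal A=\mathbb Z[q^{1/2},q^{-1/2}]$. The Hecke algebra $\mathcal H(X)$ is the associative $\mathcal A$-algebra with linear basis $\{T_w: w\in W(X)\}$, identity $T_e$, and $T_wT_s=T_{ws}$ if $\ell(ws)>\ell(w)$, $T_wT_s=qT_{ws}+(q-1)T_w$ if $\ell(ws)<\ell(w)$ ($s\in S(X)$). Let $J(X)$ be the two-sided ideal generated by all $\sum_{w\in\langle s_a,s_b\rangle}T_w$, where $(s_a,s_b)$ runs over pairs of non-commuting generators. The Temperley--Lieb algebra is $TL(X)=\mathcal H(X)/J(X)$;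 let $t_w$ be the image of $T_w$ in $TL(X)$. An element $w$ is fully commutative if any reduced expression for $w$ can be obtained from any other by using only Coxeter relations involving commuting generators; $W_c(X)$ is the set of such elements (the element with reduced expression $s_is_{i+1}\cdots s_{i+k}$, denoted $x$ in the claim, and the element with reduced expression $s_is_{i+1}\cdots s_{i+k}\,s_{i-j}s_{i-j+1}\cdots s_i\cdots s_{i+k-1}$, denoted $w$ in the claim, both belong to $W_c(X)$). It is known that $\{t_w: w\in W_c(X)\}$ is an $\mathcal A$-basis of $TL(X)$. Polynomials $a_{y,w}$: for $w\in W_c(X)$, the polynomials $a_{y,w}(q)\in\mathbb Z[q]$ ($y\in W_c(X)$, $y\le w$) are the unique ones with $(t_{w^{-1}})^{-1}=q^{-\ell(w)}\sum_{y\in W_c(X),\,y\le w}a_{y,w}(q)\,t_y$. *)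

theory Defs
  imports
    "HOL-Algebra.Generated_Groups"
    "HOL-Algebra.QuotRing"
    "HOL-Algebra.Module"
    "HOL-Library.Poly_Mapping"
    "HOL-Computational_Algebra.Polynomial"
begin

section \<open>The Coxeter group of type A\<close>

text \<open>
  A word over the generators is a list of indices from \<open>{1..n}\<close>. The group is given by the Coxeter
  presentation \<open>(s\<^sub>a s\<^sub>b)^m(a,b) = 1\<close>: since \<open>m a a = 1\<close>, every generator is its own inverse, so
  the quotient of the free monoid of words is already the presented group. An element of the group
  is thus the set of all words that are expressions for it.
\<close>

definition cox_m :: "nat \<Rightarrow> nat \<Rightarrow> nat" where
  "cox_m a b = (if a = b then 1 else if b = Suc a \<or> a = Suc b then 3 else 2)"

definition cox_words :: "nat \<Rightarrow> nat list set" where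
  "cox_words n = lists {1..n}"

inductive cox_step :: "nat \<Rightarrow> nat list \<Rightarrow> nat list \<Rightarrow> bool" for n where
  "\<lbrakk>u \<in> cox_words n; v \<in> cox_words n; a \<in> {1..n}; b \<in> {1..n}\<rbrakk>
    \<Longrightarrow> cox_step n (u @ concat (replicate (cox_m a b) [a, b]) @ v) (u @ v)"

definition cox_rel :: "nat \<Rightarrow> (nat list \<times> nat list) set" where
  "cox_rel n = {(u, v). u \<in> cox_words n \<and> v \<in> cox_words n \<and> equivclp (cox_step n) u v}"

definition cox_elem :: "nat \<Rightarrow> nat list \<Rightarrow> nat list set" where
  "cox_elem n u = cox_rel n `` {u}"

definition coxA :: "nat \<Rightarrow> nat list set monoid" where
  "coxA n = \<lparr>carrier = cox_words n // cox_rel n,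
             monoid.mult = (\<lambda>x y. \<Union>u\<in>x. \<Union>v\<in>y. cox_elem n (u @ v)),
             one = cox_elem n []\<rparr>"

definition cox_gen :: "nat \<Rightarrow> nat \<Rightarrow> nat list set" where
  "cox_gen n a = cox_elem n [a]"

definition cox_length :: "nat list set \<Rightarrow> nat" where
  "cox_length w = (LEAST l. \<exists>u\<in>w. length u = l)"

definition reduced_expression :: "nat \<Rightarrow> nat list \<Rightarrow> nat list set \<Rightarrow> bool" where
  "reduced_expression n u w \<longleftrightarrow>
     u \<in> cox_words n \<and> cox_elem n u = w \<and> length u = cox_length w"

definition cox_reflections :: "nat \<Rightarrow> nat list set set" where
  "cox_reflections n =
     {g \<otimes>\<^bsub>coxA n\<^esub> cox_gen n a \<otimes>\<^bsub>coxA n\<^esub> inv\<^bsub>coxA n\<^esub> g | g a. g \<in> carrier (coxA n) \<and> a \<in> {1..n}}"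

definition bruhat_step :: "nat \<Rightarrow> nat list set \<Rightarrow> nat list set \<Rightarrow> bool" where
  "bruhat_step n y w \<longleftrightarrow> y \<in> carrier (coxA n) \<and>
     (\<exists>t\<in>cox_reflections n. w = y \<otimes>\<^bsub>coxA n\<^esub> t) \<and> cox_length y < cox_length w"

definition bruhat_le :: "nat \<Rightarrow> nat list set \<Rightarrow> nat list set \<Rightarrow> bool" where
  "bruhat_le n = (bruhat_step n)\<^sup>*\<^sup>*"

inductive comm_step :: "nat list \<Rightarrow> nat list \<Rightarrow> bool" where
  "cox_m a b = 2 \<Longrightarrow> comm_step (u @ [a, b] @ v) (u @ [b, a] @ v)"

definition fully_commutative :: "nat \<Rightarrow> nat list set set" where
  "fully_commutative n = {w \<in> carrier (coxA n).
     \<forall>u v. reduced_expression n u w \<and> reduced_expression n v w \<longrightarrow> comm_step\<^sup>*\<^sup>* u v}"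

section \<open>Laurent polynomials\<close>

text \<open>
  The ring of Laurent polynomials over the integers in \<open>q^(1/2)\<close> is the group ring of the additive
  group of integers; \<open>single m c\<close> stands for \<open>c * q^(m/2)\<close>.
\<close>

type_synonym laurent = "int \<Rightarrow>\<^sub>0 int"

definition laurent_ring :: "laurent ring" where
  "laurent_ring = \<lparr>carrier = UNIV, monoid.mult = (*), one = 1, zero = 0, add = (+)\<rparr>"

definition qpow :: "int \<Rightarrow> laurent" where
  "qpow m = Poly_Mapping.single (2 * m) 1"

definition laurent_of_poly :: "int poly \<Rightarrow> laurent" where
  "laurent_of_poly p = poly (map_poly of_int p) (qpow 1)"

section \<open>Hecke and Temperley-Lieb algebras\<close>

text \<open>
  The locale \<open>algebra\<close> of the library presupposes a commutative multiplication, so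
  bilinearity over the scalars is added here to \<open>ring\<close> and \<open>module\<close>. The Hecke algebra is
  characterised, up to unique isomorphism, by its basis and multiplication rules. The Coxeter
  group is finite, so the basis condition needs no condition of finite support, and the sums over
  subsets of the group are genuine finite sums.
\<close>

locale hecke_algebra = ring H + Module.module laurent_ring H
  for n :: nat and H :: "(laurent, 'h) module" and T :: "nat list set \<Rightarrow> 'h" +
  assumes smult_mult_left:
      "\<And>c x y. \<lbrakk>x \<in> carrier H; y \<in> carrier H\<rbrakk>
        \<Longrightarrow> (c \<odot>\<^bsub>H\<^esub> x) \<otimes>\<^bsub>H\<^esub> y = c \<odot>\<^bsub>H\<^esub> (x \<otimes>\<^bsub>H\<^esub> y)"
    and smult_mult_right:
      "\<And>c x y. \<lbrakk>x \<in> carrier H; y \<in> carrier H\<rbrakk>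
        \<Longrightarrow> x \<otimes>\<^bsub>H\<^esub> (c \<odot>\<^bsub>H\<^esub> y) = c \<odot>\<^bsub>H\<^esub> (x \<otimes>\<^bsub>H\<^esub> y)"
    and T_closed: "\<And>w. w \<in> carrier (coxA n) \<Longrightarrow> T w \<in> carrier H"
    and T_basis: "\<And>h. h \<in> carrier H \<Longrightarrow>
        \<exists>!c. c \<in> carrier (coxA n) \<rightarrow>\<^sub>E (UNIV :: laurent set) \<and>
             h = (\<Oplus>\<^bsub>H\<^esub>w\<in>carrier (coxA n). c w \<odot>\<^bsub>H\<^esub> T w)"
    and T_one: "T \<one>\<^bsub>coxA n\<^esub> = \<one>\<^bsub>H\<^esub>"
    and T_mult_up: "\<And>w a. \<lbrakk>w \<in> carrier (coxA n); a \<in> {1..n};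
          cox_length (w \<otimes>\<^bsub>coxA n\<^esub> cox_gen n a) > cox_length w\<rbrakk>
        \<Longrightarrow> T w \<otimes>\<^bsub>H\<^esub> T (cox_gen n a) = T (w \<otimes>\<^bsub>coxA n\<^esub> cox_gen n a)"
    and T_mult_down: "\<And>w a. \<lbrakk>w \<in> carrier (coxA n); a \<in> {1..n};
          cox_length (w \<otimes>\<^bsub>coxA n\<^esub> cox_gen n a) < cox_length w\<rbrakk>
        \<Longrightarrow> T w \<otimes>\<^bsub>H\<^esub> T (cox_gen n a) =
            qpow 1 \<odot>\<^bsub>H\<^esub> T (w \<otimes>\<^bsub>coxA n\<^esub> cox_gen n a) \<oplus>\<^bsub>H\<^esub> (qpow 1 - 1) \<odot>\<^bsub>H\<^esub> T w"

definition TL_ideal ::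
    "nat \<Rightarrow> (laurent, 'h) module \<Rightarrow> (nat list set \<Rightarrow> 'h) \<Rightarrow> 'h set" where
  "TL_ideal n H T = Idl\<^bsub>H\<^esub>
     {\<Oplus>\<^bsub>H\<^esub>w\<in>generate (coxA n) {cox_gen n a, cox_gen n b}. T w | a b.
        a \<in> {1..n} \<and> b \<in> {1..n} \<and>
        cox_gen n a \<otimes>\<^bsub>coxA n\<^esub> cox_gen n b \<noteq> cox_gen n b \<otimes>\<^bsub>coxA n\<^esub> cox_gen n a}"

text \<open>The quotient ring, equipped with the induced scalar multiplication.\<close>

definition TL_algebra ::
    "nat \<Rightarrow> (laurent, 'h) module \<Rightarrow> (nat list set \<Rightarrow> 'h) \<Rightarrow> (laurent, 'h set) module" where
  "TL_algebra n H T = ring.extend (H Quot TL_ideal n H T)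
     (Module.module.fields (\<lambda>c X. \<Union>h\<in>X. TL_ideal n H T +>\<^bsub>H\<^esub> (c \<odot>\<^bsub>H\<^esub> h)))"

definition TL_t ::
    "nat \<Rightarrow> (laurent, 'h) module \<Rightarrow> (nat list set \<Rightarrow> 'h) \<Rightarrow> nat list set \<Rightarrow> 'h set" where
  "TL_t n H T w = TL_ideal n H T +>\<^bsub>H\<^esub> T w"

text \<open>
  The family of polynomials \<open>y \<mapsto> a\<^bsub>y,w\<^esub>\<close> for a fixed fully commutative \<open>w\<close>. The condition determines it
  only on the fully commutative \<open>y \<le> w\<close>.
\<close>

definition is_a_family ::
    "nat \<Rightarrow> (laurent, 'h) module \<Rightarrow> (nat list set \<Rightarrow> 'h) \<Rightarrow> nat list set
      \<Rightarrow> (nat list set \<Rightarrow> int poly) \<Rightarrow> bool" where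
  "is_a_family n H T w a \<longleftrightarrow>
     inv\<^bsub>TL_algebra n H T\<^esub> (TL_t n H T (inv\<^bsub>coxA n\<^esub> w)) =
       qpow (- int (cox_length w)) \<odot>\<^bsub>TL_algebra n H T\<^esub>
         (\<Oplus>\<^bsub>TL_algebra n H T\<^esub>y\<in>{y \<in> fully_commutative n. bruhat_le n y w}.
            laurent_of_poly (a y) \<odot>\<^bsub>TL_algebra n H T\<^esub> TL_t n H T y)"

end

theory Submission
  imports Defs "HOL-Combinatorics.Permutations" "HOL-Library.Sublist" "HOL-Algebra.UnivPoly"
begin

text \<open>Write \<open>X = s\<^sub>i \<dots> s\<^bsub>i+k\<^esub>\<close> and \<open>B = s\<^bsub>i-j\<^esub> \<dots> s\<^bsub>i+k-1\<^esub>\<close>, so that \<open>w = X B\<close> and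
  \<open>x = X\<close>. Because \<open>T\<^sub>s\<^sup>-\<^sup>1 = q\<^sup>-\<^sup>1 (T\<^sub>s + 1 - q)\<close>, the inverse of \<open>t\<close> at \<open>w\<^sup>-\<^sup>1\<close> is the product of these
  factors along the word \<open>X B\<close>. Every \<open>y \<le> w\<close> has a reduced expression that is a subword of
  \<open>X B\<close>, so \<open>t\<^sub>y\<close> too is a product of linear factors \<open>\<alpha>\<^sub>s T\<^sub>s + \<beta>\<^sub>s\<close> along \<open>X B\<close>, each of them being
  \<open>T\<^sub>s\<close> or \<open>1\<close>. The theorem follows by applying to both sides of the defining equation a linear
  form \<open>F\<close> on the Temperley-Lieb algebra whose value at the product with coefficients
  \<open>\<alpha>, \<beta>\<close> along \<open>X\<close> and \<open>\<alpha>', \<beta>'\<close> along \<open>B\<close> is the product of all \<open>- \<alpha>\<^sub>b\<close>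
  with \<open>i \<le> b \<le> i + k\<close>, all \<open>\<beta>'\<^sub>b\<close> with \<open>b < i\<close>, and all \<open>\<beta>'\<^sub>b - \<alpha>'\<^sub>b\<close> with \<open>b \<ge> i\<close>
  (\<open>two_run_form\<close>).

  At a reduced subword, \<open>F\<close> vanishes unless the subword contains all of \<open>X\<close> and no letter of
  \<open>B\<close> below \<open>i\<close>. If it then contains a letter of \<open>B\<close> at all, the first such letter \<open>b\<close>
  commutes back to the factor \<open>s\<^sub>b s\<^bsub>b+1\<^esub>\<close> of \<open>X\<close> and gives \<open>s\<^sub>b s\<^bsub>b+1\<^esub> s\<^sub>b\<close>, so the element is not
  fully commutative (\<open>fully_commutative_run_then_word\<close>). Thus \<open>F\<close> annihilates every \<open>t\<^sub>y\<close> of the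
  expansion except \<open>t\<^sub>x\<close>, where it is \<open>(-1)\<^sup>k\<^sup>+\<^sup>1\<close>; at the inverse the factors \<open>q\<^sup>-\<^sup>1 (1 - q)\<close> and
  \<open>q\<^sup>-\<^sup>1 (1 - q) - q\<^sup>-\<^sup>1\<close> give \<open>(1 - q)\<^sup>j\<close> and \<open>(- q)\<^sup>k\<close> up to powers of \<open>q\<close>.

  The form comes from the action of the Hecke algebra on words in two colours, in which \<open>T\<^sub>a\<close> mixes
  the positions \<open>a\<close> and \<open>a + 1\<close> and is \<open>- 1\<close> if they have the same colour. Among
  three positions two agree in colour, so this action factors through the Temperley-Lieb algebra
  (\<open>hecke_act_A2\<close>). Consider the matrix coefficient from the word with dark positions
  \<open>U \<union> {i}\<close> to the one with dark positions \<open>U \<union> {i + k + 1}\<close>, where \<open>U \<subseteq> {i - j..<i}\<close>. Only the full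
  \<open>X\<close> transports the dark position from \<open>i\<close> to \<open>i + k + 1\<close>, and along \<open>B\<close> only diagonal
  entries contribute. \<open>F\<close> is a sum of these coefficients over \<open>U\<close> whose weights resemble a Markov
  trace: they are chosen so that at each \<open>b < i\<close> the diagonal entries of \<open>T\<^sub>b\<close> cancel
  (\<open>weighted_diagonal_sum\<close>).

  Equivariant maps from the Hecke algebra to coloured words are given by an explicit formula on its basis:
  \<open>T\<^sub>u\<close> goes, up to the sign of \<open>u\<close>, to the word obtained from the permutation \<open>u\<close> by making the
  values up to some \<open>m\<close> dark. For this the presented group is identified with the
  symmetric group, lengths with numbers of inversions, and descents with descents of permutations.\<close>

section \<open>Words and the Coxeter presentation\<close>

lemma cox_words_simps [simp]:
  "[] \<in> cox_words n"
  "a # u \<in> cox_words n \<longleftrightarrow> a \<in> {1..n} \<and> u \<in> cox_words n"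
  "u @ v \<in> cox_words n \<longleftrightarrow> u \<in> cox_words n \<and> v \<in> cox_words n"
  "rev u \<in> cox_words n \<longleftrightarrow> u \<in> cox_words n"
  by (auto simp: cox_words_def)

lemma cox_words_replicate_pair:
  assumes "a \<in> {1..n}" "b \<in> {1..n}"
  shows "concat (replicate m [a, b]) \<in> cox_words n"
  using assms by (induction m) auto

lemma cox_rel_refl: "u \<in> cox_words n \<Longrightarrow> (u, u) \<in> cox_rel n"
  by (auto simp: cox_rel_def equivclp_def)

lemma cox_rel_sym: "(u, v) \<in> cox_rel n \<Longrightarrow> (v, u) \<in> cox_rel n"
  by (auto simp: cox_rel_def intro: equivclp_sym)

lemma cox_rel_trans [trans]:
  "(u, v) \<in> cox_rel n \<Longrightarrow> (v, w) \<in> cox_rel n \<Longrightarrow> (u, w) \<in> cox_rel n"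
  unfolding cox_rel_def by (auto intro: transpD[OF transp_equivclp])

lemma cox_rel_words: "(u, v) \<in> cox_rel n \<Longrightarrow> u \<in> cox_words n \<and> v \<in> cox_words n"
  by (auto simp: cox_rel_def)

lemma cox_rel_equiv: "equiv (cox_words n) (cox_rel n)"
  by (rule equivI)
    (auto simp: refl_on_def sym_def trans_def dest: cox_rel_words intro: cox_rel_refl cox_rel_sym cox_rel_trans)

lemma cox_step_context:
  assumes "cox_step n u v" "p \<in> cox_words n" "s \<in> cox_words n"
  shows "cox_step n (p @ u @ s) (p @ v @ s)"
  using assms(1)
proof cases
  case (1 u' v' a b)
  have "cox_step n ((p @ u') @ concat (replicate (cox_m a b) [a, b]) @ (v' @ s))
     ((p @ u') @ (v' @ s))"
    using 1 assms(2,3) by (intro cox_step.intros) auto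
  then show ?thesis using 1 by simp
qed

lemma cox_rel_context:
  assumes "(u, v) \<in> cox_rel n" "p \<in> cox_words n" "s \<in> cox_words n"
  shows "(p @ u @ s, p @ v @ s) \<in> cox_rel n"
proof -
  have "equivclp (cox_step n) u v" using assms(1) by (simp add: cox_rel_def)
  then have "equivclp (cox_step n) (p @ u @ s) (p @ v @ s)"
  proof (induction rule: equivclp_induct)
    case base
    show ?case by (simp add: equivclp_def)
  next
    case (step y z)
    then have "cox_step n (p @ y @ s) (p @ z @ s) \<or> cox_step n (p @ z @ s) (p @ y @ s)"
      using cox_step_context assms(2,3) by blast
    then have "equivclp (cox_step n) (p @ y @ s) (p @ z @ s)"
      by (auto simp: equivclp_def symclp_def)
    with step.IH show ?case by (auto intro: transpD[OF transp_equivclp])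
  qed
  then show ?thesis using assms cox_rel_words[OF assms(1)] by (simp add: cox_rel_def)
qed

lemma cox_rel_append:
  assumes "(u, u') \<in> cox_rel n" "(v, v') \<in> cox_rel n"
  shows "(u @ v, u' @ v') \<in> cox_rel n"
proof -
  note w = cox_rel_words[OF assms(1)] cox_rel_words[OF assms(2)]
  have "(u @ v, u' @ v) \<in> cox_rel n"
    using cox_rel_context[OF assms(1), of "[]" v] w by simp
  also have "(u' @ v, u' @ v') \<in> cox_rel n"
    using cox_rel_context[OF assms(2), of u' "[]"] w by simp
  finally show ?thesis .
qed

lemma cox_rel_relator:
  assumes "a \<in> {1..n}" "b \<in> {1..n}"
  shows "(concat (replicate (cox_m a b) [a, b]), []) \<in> cox_rel n"
proof -
  have "cox_step n ([] @ concat (replicate (cox_m a b) [a, b]) @ []) ([] @ [])"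
    using assms by (intro cox_step.intros) auto
  then show ?thesis using assms cox_words_replicate_pair
    by (auto simp: cox_rel_def equivclp_def symclp_def)
qed

lemma cox_rel_square: "a \<in> {1..n} \<Longrightarrow> ([a, a], []) \<in> cox_rel n"
  using cox_rel_relator[of a n a] by (simp add: cox_m_def)

lemma cox_rel_rev:
  "u \<in> cox_words n \<Longrightarrow> (u @ rev u, []) \<in> cox_rel n"
proof (induction u)
  case Nil
  then show ?case by (auto intro: cox_rel_refl)
next
  case (Cons a u)
  have "([a] @ (u @ rev u) @ [a], [a] @ [] @ [a]) \<in> cox_rel n"
    using Cons by (intro cox_rel_context) auto
  also have "([a] @ [] @ [a], []) \<in> cox_rel n" using cox_rel_square Cons by simp
  finally show ?case by simp
qed

text \<open>As every generator is an involution, a relator can be cut anywhere, the second part being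
  reversed. This yields the commutation and the braid relation.\<close>

lemma cox_rel_cut:
  assumes "(u @ v, []) \<in> cox_rel n"
  shows "(u, rev v) \<in> cox_rel n"
proof -
  have w: "u \<in> cox_words n" "v \<in> cox_words n" using cox_rel_words[OF assms] by auto
  have "(u, u @ (v @ rev v)) \<in> cox_rel n"
    using cox_rel_context[OF cox_rel_sym[OF cox_rel_rev[OF w(2)]], of u "[]"] w by simp
  also have "(u @ (v @ rev v), rev v) \<in> cox_rel n"
    using cox_rel_context[OF assms, of "[]" "rev v"] w by simp
  finally show ?thesis .
qed

lemma cox_rel_commute:
  assumes "a \<in> {1..n}" "b \<in> {1..n}" "cox_m a b = 2"
  shows "([a, b], [b, a]) \<in> cox_rel n"
  using cox_rel_relator[OF assms(1,2)] assms(3) cox_rel_cut[of "[a, b]" "[a, b]"]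
  by (simp add: numeral_eq_Suc)

lemma cox_rel_braid:
  assumes "a \<in> {1..n}" "b \<in> {1..n}" "cox_m a b = 3"
  shows "([a, b, a], [b, a, b]) \<in> cox_rel n"
  using cox_rel_relator[OF assms(1,2)] assms(3) cox_rel_cut[of "[a, b, a]" "[b, a, b]"]
  by (simp add: numeral_eq_Suc)

lemma cox_rel_commute_word:
  assumes "a \<in> {1..n}" "u \<in> cox_words n" "\<And>b. b \<in> set u \<Longrightarrow> cox_m b a = 2"
  shows "(u @ [a], [a] @ u) \<in> cox_rel n"
  using assms(2,3)
proof (induction u)
  case Nil
  then show ?case using assms(1) by (auto intro: cox_rel_refl)
next
  case (Cons b u)
  have "([b] @ (u @ [a]) @ [], [b] @ ([a] @ u) @ []) \<in> cox_rel n"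
    using Cons by (intro cox_rel_context) auto
  moreover have "([] @ [b, a] @ u, [] @ [a, b] @ u) \<in> cox_rel n"
    using Cons assms(1) by (intro cox_rel_context cox_rel_commute) auto
  ultimately show ?case using cox_rel_trans by simp
qed

section \<open>Words as permutations\<close>

abbreviation adj :: "nat \<Rightarrow> nat \<Rightarrow> nat" where
  "adj a \<equiv> transpose a (Suc a)"

definition perm :: "nat list \<Rightarrow> nat \<Rightarrow> nat" where
  "perm u = foldr (\<lambda>a p. adj a \<circ> p) u id"

lemma perm_Nil [simp]: "perm [] = id"
  and perm_Cons [simp]: "perm (a # u) = adj a \<circ> perm u"
  by (simp_all add: perm_def)

lemma perm_append [simp]: "perm (u @ v) = perm u \<circ> perm v"
  by (induction u) auto

lemma bij_perm: "bij (perm u)"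
  by (induction u) (simp_all only: perm_Nil perm_Cons bij_id bij_comp bij_transpose)

lemma perm_eq_iff [simp]: "perm u x = perm u y \<longleftrightarrow> x = y"
  using bij_perm[of u] by (simp add: bij_def inj_eq)

lemma perm_fix: "(\<And>a. a \<in> set u \<Longrightarrow> x \<noteq> a \<and> x \<noteq> Suc a) \<Longrightarrow> perm u x = x"
  by (induction u) auto

lemma perm_fix_outside:
  assumes "u \<in> cox_words n" "x = 0 \<or> x > Suc n"
  shows "perm u x = x"
  using assms by (intro perm_fix) (fastforce simp: cox_words_def)

lemma perm_in_range:
  assumes "u \<in> cox_words n" "1 \<le> x" "x \<le> Suc n"
  shows "1 \<le> perm u x" "perm u x \<le> Suc n"
proof -
  have "perm u x = x" if "perm u x = 0 \<or> perm u x > Suc n"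
    using perm_fix_outside[OF assms(1) that] by simp
  then show "1 \<le> perm u x" "perm u x \<le> Suc n" using assms(2,3) by fastforce+
qed

lemma perm_relator: "perm (concat (replicate (cox_m a b) [a, b])) = id"
proof -
  have "adj a \<circ> (adj b \<circ> (adj a \<circ> (adj b \<circ> id))) = id" if "a \<noteq> b" "b \<noteq> Suc a" "a \<noteq> Suc b"
    by (rule ext) (use that in \<open>simp add: transpose_def\<close>)
  moreover have "adj a \<circ> (adj b \<circ> (adj a \<circ> (adj b \<circ> (adj a \<circ> (adj b \<circ> id))))) = id"
    if "b = Suc a \<or> a = Suc b"
    by (rule ext) (use that in \<open>elim disjE; simp add: transpose_def\<close>)
  ultimately show ?thesis by (simp add: cox_m_def numeral_eq_Suc del: o_apply)
qed

lemma perm_cong: "(u, v) \<in> cox_rel n \<Longrightarrow> perm u = perm v"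
proof -
  assume "(u, v) \<in> cox_rel n"
  then have "equivclp (cox_step n) u v" by (simp add: cox_rel_def)
  then show ?thesis
  proof (induction rule: equivclp_induct)
    case (step y z)
    have "perm y = perm z" if "cox_step n y z" for y z
      using that by cases (simp add: perm_relator)
    with step show ?case by metis
  qed simp
qed

text \<open>The normal form of the symmetric group along the chain of parabolic subgroups: the
  descending words \<open>m, m - 1, \<dots>, p\<close> represent the cosets of \<open>\<langle>s\<^sub>1, \<dots>, s\<^bsub>m-1\<^esub>\<rangle>\<close> in
  \<open>\<langle>s\<^sub>1, \<dots>, s\<^sub>m\<rangle>\<close>. A generator multiplied to such a word from the right either changes \<open>p\<close> by
  one or passes to the left, where it stays below \<open>m\<close>.\<close>

lemma descending_run_step:
  assumes "1 \<le> p" "p \<le> Suc m" "1 \<le> a" "a \<le> m" "m \<le> n"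
  shows "\<exists>v p'. v \<in> cox_words (m - 1) \<and> 1 \<le> p' \<and> p' \<le> Suc m \<and>
    (rev [p..<Suc m] @ [a], v @ rev [p'..<Suc m]) \<in> cox_rel n"
proof -
  have words: "u \<in> cox_words n" if "set u \<subseteq> {1..m}" for u
    using that assms by (auto simp: cox_words_def)
  consider "a + 1 < p" | "a + 1 = p" | "a = p" | "a > p" by linarith
  then show ?thesis
  proof cases
    case 1
    have "(rev [p..<Suc m] @ [a], [a] @ rev [p..<Suc m]) \<in> cox_rel n"
      using 1 assms by (intro cox_rel_commute_word words) (auto simp: cox_m_def)
    then show ?thesis using 1 assms by (intro exI[of _ "[a]"] exI[of _ p]) auto
  next
    case 2
    then have "rev [p..<Suc m] @ [a] = rev [a..<Suc m]"
      using assms upt_conv_Cons[of a "Suc m"] by simp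
    then show ?thesis using 2 assms
      by (intro exI[of _ "[]"] exI[of _ a]) (auto intro!: cox_rel_refl words)
  next
    case 3
    have "rev [p..<Suc m] @ [a] = rev [Suc p..<Suc m] @ [a, a] @ []"
      using assms 3 upt_conv_Cons[of p "Suc m"] by simp
    also have "(\<dots>, rev [Suc p..<Suc m] @ [] @ []) \<in> cox_rel n"
      using assms by (intro cox_rel_context cox_rel_square words) auto
    finally show ?thesis using 3 assms
      by (intro exI[of _ "[]"] exI[of _ "Suc p"]) auto
  next
    case 4
    define h where "h = rev [Suc a..<Suc m]"
    define t where "t = rev [p..<a - 1]"
    have "[p..<Suc m] = [p..<a - 1] @ [a - 1, a] @ [Suc a..<Suc m]"
    proof -
      have "[p..<Suc m] = [p..<a - 1] @ [a - 1..<Suc m]"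
        using 4 assms upt_add_eq_append[of p "a - 1" "Suc m - (a - 1)"] by simp
      then show ?thesis
        using 4 assms upt_conv_Cons[of "a - 1" "Suc m"] upt_conv_Cons[of a "Suc m"] by simp
    qed
    then have run: "rev [p..<Suc m] = h @ [a, a - 1] @ t" by (simp add: h_def t_def)
    have w: "h \<in> cox_words n" "t \<in> cox_words n"
      using 4 assms by (auto simp: h_def t_def intro!: words)
    have "((h @ [a, a - 1]) @ (t @ [a]) @ [], (h @ [a, a - 1]) @ ([a] @ t) @ []) \<in> cox_rel n"
      using 4 assms w
      by (intro cox_rel_context cox_rel_commute_word) (auto simp: t_def cox_m_def)
    moreover have "(h @ [a, a - 1, a] @ t, h @ [a - 1, a, a - 1] @ t) \<in> cox_rel n"
      using 4 assms w by (intro cox_rel_context cox_rel_braid) (auto simp: cox_m_def)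
    moreover have "([] @ (h @ [a - 1]) @ ([a, a - 1] @ t), [] @ ([a - 1] @ h) @ ([a, a - 1] @ t)) \<in> cox_rel n"
      using 4 assms w
      by (intro cox_rel_context cox_rel_commute_word) (auto simp: h_def cox_m_def)
    ultimately have "(h @ [a, a - 1] @ t @ [a], [a - 1] @ h @ [a, a - 1] @ t) \<in> cox_rel n"
      by (simp, blast intro: cox_rel_trans)
    then show ?thesis using 4 assms run
      by (intro exI[of _ "[a - 1]"] exI[of _ p]) auto
  qed
qed

lemma normal_form:
  assumes "u \<in> cox_words m" "m \<le> n"
  shows "\<exists>v p. v \<in> cox_words (m - 1) \<and> 1 \<le> p \<and> p \<le> Suc m \<and>
    (u, v @ rev [p..<Suc m]) \<in> cox_rel n"
  using assms(1)
proof (induction u rule: rev_induct)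
  case Nil
  show ?case by (intro exI[of _ "[]"] exI[of _ "Suc m"]) (auto intro: cox_rel_refl)
next
  case (snoc a u)
  then obtain v p where v: "v \<in> cox_words (m - 1)" "1 \<le> p" "p \<le> Suc m"
    "(u, v @ rev [p..<Suc m]) \<in> cox_rel n" by auto
  obtain v' p' where v': "v' \<in> cox_words (m - 1)" "1 \<le> p'" "p' \<le> Suc m"
    "(rev [p..<Suc m] @ [a], v' @ rev [p'..<Suc m]) \<in> cox_rel n"
    using descending_run_step[of p m a n] v snoc.prems assms(2) by auto
  have wv: "v \<in> cox_words n" and wa: "[a] \<in> cox_words n"
    using v(1) snoc.prems assms(2) by (fastforce simp: cox_words_def)+
  have "(u @ [a], (v @ rev [p..<Suc m]) @ [a]) \<in> cox_rel n"
    by (rule cox_rel_append[OF v(4) cox_rel_refl[OF wa]])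
  also have "((v @ rev [p..<Suc m]) @ [a], v @ (v' @ rev [p'..<Suc m])) \<in> cox_rel n"
    using cox_rel_append[OF cox_rel_refl[OF wv] v'(4)] by simp
  finally show ?case using v(1) v'
    by (intro exI[of _ "v @ v'"] exI[of _ p']) auto
qed

lemma perm_descending_run: "p \<le> Suc m \<Longrightarrow> perm (rev [p..<Suc m]) p = Suc m"
proof (induction m)
  case 0
  then show ?case by (cases p) auto
next
  case (Suc m)
  show ?case
  proof (cases "p = Suc (Suc m)")
    case False
    then show ?thesis using Suc by simp
  qed simp
qed

text \<open>By the normal form the presented group has no relations beyond those of the symmetric group:
  a word that represents the identity must fix \<open>m + 1\<close>, so its descending run is empty.\<close>

lemma perm_id_imp_trivial:
  assumes "u \<in> cox_words m" "m \<le> n" "perm u = id"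
  shows "(u, []) \<in> cox_rel n"
  using assms
proof (induction m arbitrary: u)
  case 0
  then have "u = []" by (auto simp: cox_words_def)
  then show ?case by (auto intro: cox_rel_refl)
next
  case (Suc m)
  obtain v p where v: "v \<in> cox_words m" "1 \<le> p" "p \<le> Suc (Suc m)"
    "(u, v @ rev [p..<Suc (Suc m)]) \<in> cox_rel n"
    using normal_form[OF Suc.prems(1,2)] by auto
  have "perm v (perm (rev [p..<Suc (Suc m)]) p) = p"
    using perm_cong[OF v(4)] Suc.prems(3) by (metis comp_apply id_apply perm_append)
  then have "perm v (Suc (Suc m)) = p" using perm_descending_run[OF v(3)] by simp
  moreover have "perm v (Suc (Suc m)) = Suc (Suc m)" using perm_fix_outside[OF v(1)] by simp
  ultimately have "(u, v) \<in> cox_rel n" using v(4) by simp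
  moreover have "(v, []) \<in> cox_rel n"
    using Suc.IH[of v] v(1) Suc.prems perm_cong[OF calculation] by simp
  ultimately show ?case by (rule cox_rel_trans)
qed

lemma cox_rel_iff_perm:
  assumes "u \<in> cox_words n" "v \<in> cox_words n"
  shows "(u, v) \<in> cox_rel n \<longleftrightarrow> perm u = perm v"
proof
  assume eq: "perm u = perm v"
  have "perm (v @ rev v) = id" by (rule trans[OF perm_cong[OF cox_rel_rev[OF assms(2)]]]) simp
  then have "perm (u @ rev v) = id" using eq by simp
  then have "(u @ rev v, []) \<in> cox_rel n" using assms by (intro perm_id_imp_trivial) auto
  from cox_rel_cut[OF this] show "(u, v) \<in> cox_rel n" by simp
qed (rule perm_cong)

lemma perm_comp_rev: "u \<in> cox_words n \<Longrightarrow> perm u \<circ> perm (rev u) = id"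
  using perm_cong[OF cox_rel_rev] by fastforce

section \<open>Length and inversions\<close>

definition inversions :: "(nat \<Rightarrow> nat) \<Rightarrow> (nat \<times> nat) set" where
  "inversions p = {(x, y). x < y \<and> p y < p x}"

abbreviation inv_count :: "nat list \<Rightarrow> nat" where
  "inv_count u \<equiv> card (inversions (perm u))"

lemma adj_less_iff:
  assumes "x < y" "(x, y) \<noteq> (a, Suc a)"
  shows "adj a x < adj a y"
  using assms by (auto simp: transpose_def)

text \<open>Relabelling positions by an ascent permutes the inversions and adds exactly one. The pairs
  range over all naturals; for the permutation of a word only finitely many are inverted.\<close>

lemma inversions_comp_adj:
  assumes "p a < p (Suc a)"
  shows "inversions (p \<circ> adj a) = insert (a, Suc a) (map_prod (adj a) (adj a) ` inversions p)"
proof (rule Set.set_eqI)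
  fix z :: "nat \<times> nat"
  obtain x y where z: "z = (x, y)" by (cases z)
  have image: "z \<in> map_prod (adj a) (adj a) ` inversions p \<longleftrightarrow> (adj a x, adj a y) \<in> inversions p"
    unfolding z by (auto simp: image_iff intro!: bexI[of _ "(adj a x, adj a y)"])
  show "z \<in> inversions (p \<circ> adj a) \<longleftrightarrow>
    z \<in> insert (a, Suc a) (map_prod (adj a) (adj a) ` inversions p)"
  proof (cases "z = (a, Suc a)")
    case True
    then show ?thesis using assms by (auto simp: inversions_def)
  next
    case False
    have "x < y \<longleftrightarrow> adj a x < adj a y" if "p (adj a y) < p (adj a x)"
    proof
      assume "adj a x < adj a y"
      moreover have "(adj a x, adj a y) \<noteq> (a, Suc a)"
      proof
        assume "(adj a x, adj a y) = (a, Suc a)"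
        with that assms show False by simp
      qed
      ultimately show "x < y" using adj_less_iff[of "adj a x" "adj a y" a] by simp
    qed (use False z adj_less_iff in blast)
    then have "z \<in> inversions (p \<circ> adj a) \<longleftrightarrow> (adj a x, adj a y) \<in> inversions p"
      unfolding z inversions_def by auto
    with image False show ?thesis by simp
  qed
qed

lemma inversions_id [simp]: "inversions id = {}" "inversions (\<lambda>x. x) = {}"
  by (auto simp: inversions_def)

lemma finite_inversions_comp_adj:
  assumes "inj p" "finite (inversions p)" "p a < p (Suc a)"
  shows "finite (inversions (p \<circ> adj a))" "card (inversions (p \<circ> adj a)) = Suc (card (inversions p))"
proof -
  have inj: "inj_on (map_prod (adj a) (adj a)) A" for A
    by (intro inj_on_subset[OF prod.inj_map]) auto
  have "(a, Suc a) \<notin> map_prod (adj a) (adj a) ` inversions p"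
  proof
    assume "(a, Suc a) \<in> map_prod (adj a) (adj a) ` inversions p"
    then obtain x y where xy: "(x, y) \<in> inversions p" "adj a x = a" "adj a y = Suc a" by auto
    then have "x = Suc a" "y = a" by (metis transpose_apply_first transpose_involutory,
        metis transpose_apply_second transpose_involutory)
    with xy show False by (simp add: inversions_def)
  qed
  then show "finite (inversions (p \<circ> adj a))"
    "card (inversions (p \<circ> adj a)) = Suc (card (inversions p))"
    using assms by (simp_all add: inversions_comp_adj card_image inj)
qed

lemma perm_snoc: "perm (u @ [a]) = perm u \<circ> adj a"
  by simp

lemma perm_snoc_cancel: "perm (u @ [a]) \<circ> adj a = perm u"
  unfolding perm_snoc by (simp add: comp_assoc del: perm_append)

lemma comp_transpose:
  assumes "inj p"
  shows "p \<circ> transpose x y = transpose (p x) (p y) \<circ> p"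
  using assms by (auto simp: transpose_def fun_eq_iff inj_eq)

lemma ascent_or_descent: "perm u a < perm u (Suc a) \<or> perm u (Suc a) < perm u a"
  by (metis linorder_neqE_nat n_not_Suc_n perm_eq_iff)

lemma inj_perm: "inj (perm u)"
  using bij_perm bij_def by blast

lemma finite_inversions_perm: "finite (inversions (perm u))"
proof (induction u rule: rev_induct)
  case (snoc a u)
  show ?case
  proof (cases "perm u a < perm u (Suc a)")
    case True
    then show ?thesis unfolding perm_snoc by (rule finite_inversions_comp_adj(1)[OF inj_perm snoc.IH])
  next
    case False
    define q where "q = perm (u @ [a])"
    have q: "q \<circ> adj a = perm u" unfolding q_def by (rule perm_snoc_cancel)
    have asc: "q a < q (Suc a)" using False ascent_or_descent[of u a] by (simp add: q_def)
    have "map_prod (adj a) (adj a) ` inversions q \<subseteq> inversions (perm u)"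
      using inversions_comp_adj[OF asc] q by auto
    then have "finite (map_prod (adj a) (adj a) ` inversions q)"
      using snoc.IH finite_subset by blast
    moreover have "inj_on (map_prod (adj a) (adj a)) (inversions q)"
      by (intro inj_on_subset[OF prod.inj_map]) auto
    ultimately show ?thesis unfolding q_def by (rule finite_imageD)
  qed
qed simp

lemma inv_count_ascent:
  assumes "perm u a < perm u (Suc a)"
  shows "inv_count (u @ [a]) = Suc (inv_count u)"
  unfolding perm_snoc by (rule finite_inversions_comp_adj(2)[OF inj_perm finite_inversions_perm assms])

lemma inv_count_descent:
  assumes "perm u (Suc a) < perm u a"
  shows "Suc (inv_count (u @ [a])) = inv_count u"
  using finite_inversions_comp_adj(2)[OF inj_perm finite_inversions_perm, of "u @ [a]" a] assms
  unfolding perm_snoc_cancel by (simp del: perm_append add: perm_snoc)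

lemma inv_count_le_length: "inv_count u \<le> length u"
proof (induction u rule: rev_induct)
  case (snoc a u)
  then show ?case
    using ascent_or_descent[of u a] inv_count_ascent[of u a] inv_count_descent[of u a]
    by (elim disjE; simp del: perm_append)
qed simp

lemma no_inversions_imp_id:
  assumes "inversions (perm u) = {}"
  shows "perm u = id"
proof -
  have mono: "strict_mono (perm u)"
  proof (rule strict_monoI)
    fix x y :: nat
    assume "x < y"
    then have "\<not> perm u y < perm u x" using assms by (auto simp: inversions_def)
    moreover have "perm u x \<noteq> perm u y" using \<open>x < y\<close> by simp
    ultimately show "perm u x < perm u y" by linarith
  qed
  have "perm u x = x" for x
  proof (induction x rule: less_induct)
    case (less x)
    obtain y where y: "perm u y = x" using bij_perm[of u] by (metis bij_pointE)
    have "\<not> y < x" using less.IH y by force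
    moreover have "\<not> x < y" using strict_mono_less[OF mono, of x y] y
        strict_mono_imp_increasing[OF mono, of x] by auto
    ultimately show ?case using y by simp
  qed
  then show ?thesis by auto
qed

text \<open>A permutation without adjacent inversions is monotone; outside \<open>{1..n + 1}\<close> it is the
  identity, so a descent lies in \<open>{1..n}\<close>.\<close>

lemma obtain_descent:
  assumes "u \<in> cox_words n" "inversions (perm u) \<noteq> {}"
  obtains a where "a \<in> {1..n}" "perm u (Suc a) < perm u a"
proof -
  obtain x y where xy: "x < y" "perm u y < perm u x"
    using assms(2) by (auto simp: inversions_def)
  have "\<exists>a. perm u (Suc a) < perm u a"
  proof (rule ccontr)
    assume "\<nexists>a. perm u (Suc a) < perm u a"
    then have "mono (perm u)" by (auto simp: mono_iff_le_Suc not_less)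
    then show False using xy monoD[of "perm u" x y] by simp
  qed
  then obtain a where a: "perm u (Suc a) < perm u a" by blast
  have "a \<noteq> 0" using a perm_fix_outside[OF assms(1), of 0] by (intro notI) simp
  moreover have "a \<le> n"
  proof (rule ccontr)
    assume "\<not> a \<le> n"
    then have s: "perm u (Suc a) = Suc a" using perm_fix_outside[OF assms(1)] by simp
    have "perm u a \<le> Suc a"
    proof (cases "a > Suc n")
      case False
      then show ?thesis
        using perm_in_range(2)[OF assms(1), of a] \<open>a \<noteq> 0\<close> \<open>\<not> a \<le> n\<close> by simp
    qed (simp add: perm_fix_outside[OF assms(1)])
    with s a show False by simp
  qed
  ultimately show thesis using a that[of a] by simp
qed

text \<open>Sorting by descents reaches a permutation without inversions, and by faithfulness that
  one is represented by the empty word.\<close>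

lemma exists_word_of_length_inv_count:
  assumes "u \<in> cox_words n"
  shows "\<exists>v. (u, v) \<in> cox_rel n \<and> length v = inv_count u"
  using assms
proof (induction "inv_count u" arbitrary: u)
  case 0
  then have "perm u = id" using no_inversions_imp_id finite_inversions_perm by auto
  then have "(u, []) \<in> cox_rel n" using 0 by (simp add: cox_rel_iff_perm)
  then show ?case using 0 by auto
next
  case (Suc l)
  obtain a where a: "a \<in> {1..n}" "perm u (Suc a) < perm u a"
  proof (rule obtain_descent[OF Suc.prems])
    show "inversions (perm u) \<noteq> {}" using Suc.hyps(2) by auto
  qed
  have "l = inv_count (u @ [a])" using inv_count_descent[OF a(2)] Suc.hyps(2) by simp
  then obtain v where v: "(u @ [a], v) \<in> cox_rel n" "length v = l"
    using Suc.hyps(1)[of "u @ [a]"] Suc.prems a by auto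
  have w: "v \<in> cox_words n" using cox_rel_words v(1) by blast
  have "perm u = perm (v @ [a])"
    using perm_cong[OF v(1)] perm_snoc_cancel[of u a] perm_snoc[of v a] by metis
  then have "(u, v @ [a]) \<in> cox_rel n" using Suc.prems w a by (simp add: cox_rel_iff_perm)
  then show ?case using v(2) Suc.hyps(2) by (intro exI[of _ "v @ [a]"]) simp
qed

lemma mem_cox_elem: "v \<in> cox_elem n u \<longleftrightarrow> (u, v) \<in> cox_rel n"
  by (simp add: cox_elem_def)

lemma cox_elem_eq_iff:
  assumes "u \<in> cox_words n" "v \<in> cox_words n"
  shows "cox_elem n u = cox_elem n v \<longleftrightarrow> perm u = perm v"
  using eq_equiv_class_iff[OF cox_rel_equiv assms] cox_rel_iff_perm[OF assms]
  by (simp add: cox_elem_def)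

lemma cox_length_eq_inv_count:
  assumes "u \<in> cox_words n"
  shows "cox_length (cox_elem n u) = inv_count u"
  unfolding cox_length_def
proof (rule Least_equality)
  show "\<exists>v\<in>cox_elem n u. length v = inv_count u"
    using exists_word_of_length_inv_count[OF assms] by (auto simp: mem_cox_elem)
next
  fix l
  assume "\<exists>v\<in>cox_elem n u. length v = l"
  then obtain v where "(u, v) \<in> cox_rel n" "length v = l" by (auto simp: mem_cox_elem)
  then show "inv_count u \<le> l" using inv_count_le_length[of v] perm_cong by metis
qed

abbreviation reduced :: "nat list \<Rightarrow> bool" where
  "reduced u \<equiv> length u = inv_count u"

lemma reduced_expression_iff:
  "reduced_expression n u w \<longleftrightarrow> u \<in> cox_words n \<and> cox_elem n u = w \<and> reduced u"
  using cox_length_eq_inv_count by (auto simp: reduced_expression_def)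

lemma reduced_snocD:
  assumes "reduced (u @ [a])"
  shows "reduced u" "perm u a < perm u (Suc a)"
proof -
  have "perm u a < perm u (Suc a)"
  proof (rule ccontr)
    assume "\<not> perm u a < perm u (Suc a)"
    then have "Suc (inv_count (u @ [a])) = inv_count u"
      using ascent_or_descent inv_count_descent by blast
    then show False using assms inv_count_le_length[of u] by simp
  qed
  then show "perm u a < perm u (Suc a)" "reduced u"
    using assms inv_count_ascent[of u a] by (simp_all del: perm_append)
qed

lemma reduced_prefix: "reduced (u @ v) \<Longrightarrow> reduced u"
proof (induction v rule: rev_induct)
  case (snoc a v)
  then show ?case using reduced_snocD(1)[of "u @ v" a] by (simp del: perm_append)
qed simp

section \<open>The Coxeter group\<close>

lemma carrier_coxA: "carrier (coxA n) = cox_elem n ` cox_words n"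
  by (auto simp: coxA_def quotient_def cox_elem_def)

lemma one_coxA: "\<one>\<^bsub>coxA n\<^esub> = cox_elem n []"
  by (simp add: coxA_def)

lemma mult_coxA:
  assumes "u \<in> cox_words n" "v \<in> cox_words n"
  shows "cox_elem n u \<otimes>\<^bsub>coxA n\<^esub> cox_elem n v = cox_elem n (u @ v)"
proof -
  have const: "cox_elem n (u' @ v') = cox_elem n (u @ v)"
    if "u' \<in> cox_elem n u" "v' \<in> cox_elem n v" for u' v'
  proof -
    have "(u @ v, u' @ v') \<in> cox_rel n"
      using that unfolding mem_cox_elem by (rule cox_rel_append)
    then show ?thesis unfolding cox_elem_def by (rule equiv_class_eq[OF cox_rel_equiv, symmetric])
  qed
  have mem: "u \<in> cox_elem n u" "v \<in> cox_elem n v"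
    using assms by (simp_all add: mem_cox_elem cox_rel_refl)
  have "(\<Union>u'\<in>cox_elem n u. \<Union>v'\<in>cox_elem n v. cox_elem n (u' @ v'))
      = (\<Union>u'\<in>cox_elem n u. \<Union>v'\<in>cox_elem n v. cox_elem n (u @ v))"
    by (intro SUP_cong refl const)
  also have "\<dots> = cox_elem n (u @ v)" using mem by (simp add: ex_in_conv[symmetric]) blast
  finally show ?thesis by (simp add: coxA_def)
qed

lemma rev_mult_coxA:
  assumes "u \<in> cox_words n"
  shows "cox_elem n (rev u) \<otimes>\<^bsub>coxA n\<^esub> cox_elem n u = \<one>\<^bsub>coxA n\<^esub>"
proof -
  have w: "rev u \<in> cox_words n" "rev u @ u \<in> cox_words n" "[] \<in> cox_words n" using assms by auto
  have "perm (rev u) \<circ> perm (rev (rev u)) = id" by (rule perm_comp_rev[OF w(1)])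
  then have "perm (rev u @ u) = perm []" by (simp only: rev_rev_ident perm_append perm_Nil)
  then show ?thesis
    unfolding mult_coxA[OF w(1) assms] one_coxA cox_elem_eq_iff[OF w(2,3)] .
qed

lemma group_coxA: "group (coxA n)"
proof (rule groupI)
  fix x y z
  assume "x \<in> carrier (coxA n)" "y \<in> carrier (coxA n)" "z \<in> carrier (coxA n)"
  then show "x \<otimes>\<^bsub>coxA n\<^esub> y \<otimes>\<^bsub>coxA n\<^esub> z = x \<otimes>\<^bsub>coxA n\<^esub> (y \<otimes>\<^bsub>coxA n\<^esub> z)"
    by (auto simp: carrier_coxA mult_coxA)
next
  fix x
  assume "x \<in> carrier (coxA n)"
  then obtain u where u: "u \<in> cox_words n" "x = cox_elem n u" by (auto simp: carrier_coxA)
  show "\<exists>y\<in>carrier (coxA n). y \<otimes>\<^bsub>coxA n\<^esub> x = \<one>\<^bsub>coxA n\<^esub>"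
    using u rev_mult_coxA[of u n] by (intro bexI[of _ "cox_elem n (rev u)"]) (simp_all add: carrier_coxA)
qed (auto simp: carrier_coxA mult_coxA one_coxA)

lemma inv_coxA:
  assumes "u \<in> cox_words n"
  shows "inv\<^bsub>coxA n\<^esub> (cox_elem n u) = cox_elem n (rev u)"
proof (rule group.inv_equality[OF group_coxA])
  show "cox_elem n (rev u) \<otimes>\<^bsub>coxA n\<^esub> cox_elem n u = \<one>\<^bsub>coxA n\<^esub>"
    by (rule rev_mult_coxA[OF assms])
qed (simp_all add: carrier_coxA assms)

lemma finite_carrier_coxA: "finite (carrier (coxA n))"
proof -
  define f where "f = (\<lambda>w. perm (SOME u. u \<in> cox_words n \<and> cox_elem n u = w))"
  have rep: "\<exists>u. u \<in> cox_words n \<and> cox_elem n u = w \<and> f w = perm u" if "w \<in> carrier (coxA n)" for w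
    using that someI_ex[of "\<lambda>u. u \<in> cox_words n \<and> cox_elem n u = w"]
    by (auto simp: carrier_coxA f_def)
  have "inj_on f (carrier (coxA n))"
    by (intro inj_onI) (metis rep cox_elem_eq_iff)
  moreover have "f ` carrier (coxA n) \<subseteq> {p. p permutes {1..Suc n}}"
  proof safe
    fix w
    assume "w \<in> carrier (coxA n)"
    with rep obtain u where u: "u \<in> cox_words n" "f w = perm u" by blast
    have "perm u x = x" if "x \<notin> {1..Suc n}" for x
      using that by (intro perm_fix_outside[OF u(1)]) auto
    moreover have "\<exists>!x. perm u x = y" for y using bij_perm[of u] by (simp add: bij_iff)
    ultimately show "f w permutes {1..Suc n}" by (simp add: permutes_def u(2))
  qed
  then have "finite (f ` carrier (coxA n))"
    by (rule finite_subset) (intro finite_permutations finite_atLeastAtMost)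
  ultimately show ?thesis by (meson finite_imageD)
qed

section \<open>Deletion and the Bruhat order\<close>

text \<open>Two strands that end in inverted order have crossed; deleting the letter at which they
  cross composes the permutation with their transposition.\<close>

lemma delete_crossing:
  assumes "x < z" "perm u z < perm u x"
  shows "\<exists>v. subseq v u \<and> length u = Suc (length v) \<and> perm v = perm u \<circ> transpose x z"
  using assms
proof (induction u arbitrary: x z rule: rev_induct)
  case (snoc a u)
  show ?case
  proof (cases "(x, z) = (a, Suc a)")
    case True
    then have "perm u = perm (u @ [a]) \<circ> transpose x z" by (simp only: prod.inject perm_snoc_cancel)
    then show ?thesis by (intro exI[of _ u]) (simp add: subseq_rev_drop_many del: perm_append)
  next
    case False
    then have "adj a x < adj a z" using adj_less_iff snoc.prems(1) by blast
    moreover have "perm u (adj a z) < perm u (adj a x)" using snoc.prems(2) by simp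
    ultimately obtain v where v: "subseq v u" "length u = Suc (length v)"
      "perm v = perm u \<circ> transpose (adj a x) (adj a z)" using snoc.IH by blast
    have "perm (v @ [a]) = perm (u @ [a]) \<circ> transpose x z"
      unfolding perm_snoc v(3) comp_assoc by (simp only: comp_transpose[OF inj_transpose, of a "Suc a" x z])
    then show ?thesis using v by (intro exI[of _ "v @ [a]"]) (simp del: perm_append)
  qed
qed simp

text \<open>When a letter appended to a reduced word creates a descent, deleting the crossing of the
  two strands has the same effect as appending it.\<close>

lemma reduced_subword:
  "\<exists>v. subseq v u \<and> perm v = perm u \<and> reduced v"
proof (induction u rule: rev_induct)
  case (snoc a u)
  then obtain v where v: "subseq v u" "perm v = perm u" "reduced v" by blast
  show ?case
  proof (cases "perm v a < perm v (Suc a)")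
    case True
    then have "reduced (v @ [a])" using v(3) inv_count_ascent[of v a] by (simp del: perm_append)
    then show ?thesis using v by (intro exI[of _ "v @ [a]"]) (simp only: perm_snoc subseq_append)
  next
    case False
    then have desc: "perm v (Suc a) < perm v a" using ascent_or_descent by blast
    then obtain v' where v': "subseq v' v" "length v = Suc (length v')" "perm v' = perm v \<circ> adj a"
      using delete_crossing[of a "Suc a" v] by auto
    have v'': "perm v' = perm (v @ [a])" unfolding perm_snoc by (rule v'(3))
    then have "inv_count v' = inv_count (v @ [a])" by simp
    then have "reduced v'" using inv_count_descent[OF desc] v'(2) v(3) by simp
    moreover have "subseq v' (u @ [a])" using v'(1) v(1) by (meson subseq_order.trans subseq_rev_drop_many)
    moreover have "perm v' = perm (u @ [a])" unfolding v'' perm_snoc v(2) ..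
    ultimately show ?thesis by blast
  qed
qed (rule exI[of _ "[]"]; simp)

lemma perm_conjugate_adj:
  assumes "g \<in> cox_words n"
  shows "perm (g @ [a] @ rev g) = transpose (perm g a) (perm g (Suc a))"
proof -
  have "perm (g @ [a] @ rev g) = (perm g \<circ> adj a) \<circ> perm (rev g)" by (simp add: comp_assoc)
  also have "\<dots> = transpose (perm g a) (perm g (Suc a)) \<circ> (perm g \<circ> perm (rev g))"
    by (simp only: comp_transpose[OF inj_perm] comp_assoc)
  finally show ?thesis by (simp add: perm_comp_rev[OF assms])
qed

text \<open>If the strands exchanged by the reflection did not end inverted in \<open>u\<close>, they would in \<open>y\<close>,
  and deleting their crossing from a reduced word of \<open>y\<close> would make \<open>u\<close> the shorter of the two.\<close>

lemma bruhat_step_subword: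
  assumes "u \<in> cox_words n" "bruhat_step n y (cox_elem n u)"
  shows "\<exists>v. subseq v u \<and> y = cox_elem n v"
proof -
  obtain t where t: "t \<in> cox_reflections n" "cox_elem n u = y \<otimes>\<^bsub>coxA n\<^esub> t"
    and len: "cox_length y < cox_length (cox_elem n u)" and y: "y \<in> carrier (coxA n)"
    using assms(2) by (auto simp: bruhat_step_def)
  obtain y' where y': "y' \<in> cox_words n" "y = cox_elem n y'" using y by (auto simp: carrier_coxA)
  obtain g a where g: "g \<in> cox_words n" "a \<in> {1..n}" "t = cox_elem n (g @ [a] @ rev g)"
    using t(1) by (auto simp: cox_reflections_def carrier_coxA cox_gen_def mult_coxA inv_coxA)
  obtain x z where xz: "x < z" "perm (g @ [a] @ rev g) = transpose x z"
  proof (cases "perm g a < perm g (Suc a)")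
    case True
    then show thesis using that perm_conjugate_adj[OF g(1)] by blast
  next
    case False
    then have "perm g (Suc a) < perm g a" using ascent_or_descent by blast
    then show thesis using that perm_conjugate_adj[OF g(1)] transpose_commute by metis
  qed
  have u: "perm u = perm y' \<circ> transpose x z"
  proof -
    have "cox_elem n u = cox_elem n (y' @ (g @ [a] @ rev g))"
      using t(2) y' g by (simp add: mult_coxA)
    then have "perm u = perm (y' @ (g @ [a] @ rev g))" using assms(1) y' g by (subst (asm) cox_elem_eq_iff) auto
    then show ?thesis unfolding perm_append[of y'] xz(2) .
  qed
  then have y'u: "perm y' = perm u \<circ> transpose x z" by (simp add: comp_assoc)
  have lt: "inv_count y' < inv_count u" using len y' assms(1) by (simp add: cox_length_eq_inv_count)
  have "perm u z < perm u x"
  proof (rule ccontr)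
    assume "\<not> perm u z < perm u x"
    then have "perm u x < perm u z" using xz(1) by (metis linorder_neqE_nat less_irrefl perm_eq_iff)
    then have inv: "perm y' z < perm y' x" by (simp add: y'u)
    obtain r where r: "(y', r) \<in> cox_rel n" "length r = inv_count y'"
      using exists_word_of_length_inv_count[OF y'(1)] by blast
    obtain v where "length r = Suc (length v)" "perm v = perm r \<circ> transpose x z"
      using delete_crossing[OF xz(1), of r] inv perm_cong[OF r(1)] by auto
    then have "inv_count u \<le> inv_count y'"
      using inv_count_le_length[of v] r u perm_cong[OF r(1)] by simp
    with lt show False by simp
  qed
  then obtain v where v: "subseq v u" "perm v = perm u \<circ> transpose x z"
    using delete_crossing[OF xz(1)] by blast
  have "v \<in> cox_words n" using v(1) assms(1)
    by (auto simp: cox_words_def dest: list_emb_set)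
  then have "y = cox_elem n v" using v(2) y' y'u by (simp add: cox_elem_eq_iff)
  then show ?thesis using v(1) by blast
qed

lemma bruhat_le_reduced_subword:
  assumes "u \<in> cox_words n" "bruhat_le n y (cox_elem n u)"
  shows "\<exists>v. subseq v u \<and> v \<in> cox_words n \<and> y = cox_elem n v \<and> reduced v"
proof -
  have sub: "v \<in> cox_words n" if "subseq v u" for v
    using that assms(1) by (auto simp: cox_words_def dest: list_emb_set)
  have "(bruhat_step n)\<^sup>*\<^sup>* y (cox_elem n u)" using assms(2) by (simp add: bruhat_le_def)
  then have "\<exists>v. subseq v u \<and> y = cox_elem n v"
  proof (induction rule: converse_rtranclp_induct)
    case base
    show ?case by blast
  next
    case (step y z)
    then obtain v where v: "subseq v u" "z = cox_elem n v" by blast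
    then obtain v' where "subseq v' v" "y = cox_elem n v'"
      using bruhat_step_subword[OF sub] step.hyps(1) by blast
    then show ?case using subseq_order.trans[of v' v u] v(1) by blast
  qed
  then obtain v where v: "subseq v u" "y = cox_elem n v" by blast
  obtain v' where v': "subseq v' v" "perm v' = perm v" "reduced v'" using reduced_subword by blast
  have sub': "subseq v' u" using v'(1) v(1) by (rule subseq_order.trans)
  have "y = cox_elem n v'" using v v' sub sub' cox_elem_eq_iff[of v' n v] by simp
  then show ?thesis using v'(3) sub sub' by (intro exI[of _ v']) simp
qed

lemma prefix_bruhat_le:
  assumes "u @ v \<in> cox_words n" "reduced (u @ v)"
  shows "bruhat_le n (cox_elem n u) (cox_elem n (u @ v))"
  using assms
proof (induction v rule: rev_induct)
  case (snoc a v)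
  let ?y = "cox_elem n (u @ v)"
  have red: "reduced (u @ v)" "perm (u @ v) a < perm (u @ v) (Suc a)"
    using reduced_snocD[of "u @ v" a] snoc.prems by (simp_all del: perm_append)
  have w: "u @ v \<in> cox_words n" "a \<in> {1..n}" using snoc.prems by auto
  have "cox_gen n a \<in> cox_reflections n"
    unfolding cox_reflections_def using w
    by (auto simp: cox_gen_def mult_coxA inv_coxA carrier_coxA intro!: exI[of _ "cox_elem n []"] exI[of _ a])
  moreover have "cox_elem n (u @ v @ [a]) = ?y \<otimes>\<^bsub>coxA n\<^esub> cox_gen n a"
    using w by (simp add: cox_gen_def mult_coxA)
  moreover have "cox_length ?y < cox_length (cox_elem n (u @ v @ [a]))"
    using w inv_count_ascent[OF red(2)] by (simp add: cox_length_eq_inv_count del: perm_append)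
  ultimately have "bruhat_step n ?y (cox_elem n (u @ v @ [a]))"
    using w by (auto simp: bruhat_step_def carrier_coxA)
  moreover have "bruhat_le n (cox_elem n u) ?y" by (rule snoc.IH[OF w(1) red(1)])
  ultimately show ?case unfolding bruhat_le_def by (meson rtranclp.rtrancl_into_rtrancl)
qed (simp add: bruhat_le_def)

section \<open>Full commutativity\<close>

lemma perm_ascending_run:
  assumes "i \<le> m"
  shows "perm [i..<m] x = (if x = m then i else if i \<le> x \<and> x < m then Suc x else x)"
  using assms
proof (induction m arbitrary: x)
  case (Suc m)
  show ?case
  proof (cases "i = Suc m")
    case False
    then have "i \<le> m" using Suc.prems by simp
    then show ?thesis using Suc.IH[of "adj m x"] by (auto simp: transpose_def)
  qed simp
qed simp

text \<open>The only descent of the permutation \<open>s\<^sub>i \<dots> s\<^bsub>m-1\<^esub>\<close> is \<open>m - 1\<close>, which therefore ends each of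
  its reduced words.\<close>

lemma ascending_run_unique_reduced:
  assumes "perm v = perm [i..<m]" "reduced v" "i \<le> m" "reduced [i..<m]"
  shows "v = [i..<m]"
  using assms
proof (induction m arbitrary: v)
  case 0
  then show ?case by simp
next
  case (Suc m)
  show ?case
  proof (cases "i = Suc m")
    case True
    then show ?thesis using Suc.prems by simp
  next
    case False
    then have im: "i \<le> m" using Suc.prems by simp
    have "v \<noteq> []" using Suc.prems im by (metis le_imp_less_Suc length_0_conv length_upt zero_less_diff less_irrefl)
    then obtain v' a where v: "v = v' @ [a]" by (metis rev_exhaust)
    have asc: "perm v' a < perm v' (Suc a)" and red: "reduced v'"
      using reduced_snocD[of v' a] Suc.prems(2) v by (simp_all del: perm_append)
    have "perm v' = perm v \<circ> adj a" using v perm_snoc_cancel by metis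
    then have desc: "perm v (Suc a) < perm v a" using asc by simp
    have "a = m"
      using desc Suc.prems(1,3) perm_ascending_run[of i "Suc m" a] perm_ascending_run[of i "Suc m" "Suc a"]
      by (auto split: if_splits)
    have "perm v' = perm [i..<m]"
      using \<open>perm v' = perm v \<circ> adj a\<close> perm_snoc_cancel[of "[i..<m]" m]
      unfolding Suc.prems(1) \<open>a = m\<close> upt_Suc_append[OF im] by (rule trans)
    moreover have "reduced [i..<m]"
      using Suc.prems(4) unfolding upt_Suc_append[OF im] by (rule reduced_prefix)
    ultimately show ?thesis using Suc.IH[OF _ red im] v \<open>a = m\<close> im by simp
  qed
qed

lemma ascending_run_fully_commutative:
  assumes "[i..<m] \<in> cox_words n" "reduced [i..<m]" "i \<le> m"
  shows "cox_elem n [i..<m] \<in> fully_commutative n"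
proof -
  have "v = [i..<m]" if "reduced_expression n v (cox_elem n [i..<m])" for v
    using that assms ascending_run_unique_reduced[of v i m]
    by (auto simp: reduced_expression_iff cox_elem_eq_iff)
  then show ?thesis using assms(1) by (auto simp: fully_commutative_def carrier_coxA)
qed

lemma comm_steps_mset: "comm_step\<^sup>*\<^sup>* u v \<Longrightarrow> mset u = mset v"
  by (induction rule: rtranclp_induct) (auto elim!: comm_step.cases)

text \<open>Commutations keep the letters of a word, a braid relation does not.\<close>

lemma fully_commutative_no_braid:
  assumes "cox_elem n u \<in> fully_commutative n" "u \<in> cox_words n" "reduced u"
    and "(u, p @ [a, b, a] @ s) \<in> cox_rel n" "length u = length (p @ [a, b, a] @ s)"
    and "cox_m a b = 3"
  shows False
proof -
  let ?v = "p @ [a, b, a] @ s" and ?w = "p @ [b, a, b] @ s"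
  have words: "?v \<in> cox_words n" using assms(4) cox_rel_words by blast
  then have "(?v, ?w) \<in> cox_rel n"
    using assms(6) by (intro cox_rel_context cox_rel_braid) auto
  then have uw: "(u, ?w) \<in> cox_rel n" using assms(4) cox_rel_trans by blast
  have red: "reduced_expression n x (cox_elem n u)" if "(u, x) \<in> cox_rel n" "length x = length u" for x
    using that assms(2,3) cox_rel_words[OF that(1)] perm_cong[OF that(1)] cox_elem_eq_iff[of u n x]
    by (simp add: reduced_expression_iff)
  have "comm_step\<^sup>*\<^sup>* ?v ?w"
    using assms(1) red[OF assms(4)] red[OF uw] assms(5) by (simp add: fully_commutative_def)
  then have "mset ?v = mset ?w" by (rule comm_steps_mset)
  then have "a = b" by simp
  with assms(6) show False by (simp add: cox_m_def)
qed

text \<open>The letter \<open>b\<close> commutes with \<open>b + 2, \<dots>, m - 1\<close> and so meets the letters \<open>b, b + 1\<close>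
  of the run.\<close>

lemma fully_commutative_run_then_word:
  assumes "[i..<m] @ b # v \<in> cox_words n" "reduced ([i..<m] @ b # v)"
    and "i \<le> b" "Suc b < m"
  shows "cox_elem n ([i..<m] @ b # v) \<notin> fully_commutative n"
proof
  assume fc: "cox_elem n ([i..<m] @ b # v) \<in> fully_commutative n"
  have split: "[i..<m] = [i..<b] @ [b, Suc b] @ [Suc (Suc b)..<m]"
  proof -
    have "[i..<m] = [i..<b] @ [b..<m]" using assms(3,4) upt_add_eq_append[of i b "m - b"] by simp
    then show ?thesis using assms(4) upt_conv_Cons[of b m] upt_conv_Cons[of "Suc b" m] by simp
  qed
  let ?t = "[Suc (Suc b)..<m]"
  have w: "?t \<in> cox_words n" "b \<in> {1..n}" "v \<in> cox_words n" "[i..<b] @ [b, Suc b] \<in> cox_words n"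
    using assms(1) unfolding split by auto
  have "(([i..<b] @ [b, Suc b]) @ (?t @ [b]) @ v, ([i..<b] @ [b, Suc b]) @ ([b] @ ?t) @ v) \<in> cox_rel n"
    using w by (intro cox_rel_context cox_rel_commute_word) (auto simp: cox_m_def)
  then have "([i..<m] @ b # v, [i..<b] @ [b, Suc b, b] @ (?t @ v)) \<in> cox_rel n"
    unfolding split by simp
  then show False
  proof (rule fully_commutative_no_braid[OF fc assms(1,2)])
    show "length ([i..<m] @ b # v) = length ([i..<b] @ [b, Suc b, b] @ (?t @ v))"
      unfolding split by simp
  qed (simp add: cox_m_def)
qed

section \<open>Two-coloured words\<close>

abbreviation q :: laurent where
  "q \<equiv> qpow 1"

abbreviation q_inv :: laurent where
  "q_inv \<equiv> qpow (- 1)"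

lemma qpow_add: "qpow a * qpow b = qpow (a + b)"
  by (simp add: qpow_def mult_single)

lemma qpow_0 [simp]: "qpow 0 = 1"
  by (simp add: qpow_def)

lemma q_inv [simp]: "q * q_inv = 1" "q_inv * q = 1"
  by (simp_all add: qpow_add)

lemma q_inv_q_left [simp]: "q_inv * (q * x) = x"
  by (simp add: mult.assoc[symmetric])

type_synonym colouring = "nat \<Rightarrow> bool"

text \<open>A vector assigns a coefficient to each colouring of the positions, where \<open>True\<close> is dark.
  This is the right action of \<open>T\<^sub>a\<close> on tensor powers of a plane, in the normalisation where
  \<open>T\<^sub>a\<close> is \<open>- 1\<close> on equal colours and moves a dark position at \<open>a\<close> to \<open>a + 1\<close> with
  coefficient \<open>- 1\<close>. The formula gives the coefficients of the image, whence the apparent transposition.\<close>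

definition hecke_act :: "nat \<Rightarrow> (colouring \<Rightarrow> laurent) \<Rightarrow> colouring \<Rightarrow> laurent" where
  "hecke_act a v c =
     (if c a = c (Suc a) then - v c
      else if c a then - (q * v (c(a := False, Suc a := True)))
      else (q - 1) * v c - v (c(a := True, Suc a := False)))"

lemma hecke_act_quadratic:
  "hecke_act a (hecke_act a v) c = (q - 1) * hecke_act a v c + q * v c"
proof -
  have "c(a := True, Suc a := False) = c" if "c a" "\<not> c (Suc a)"
    using that by (simp add: fun_eq_iff)
  moreover have "c(a := False, Suc a := True) = c" if "\<not> c a" "c (Suc a)"
    using that by (simp add: fun_eq_iff)
  ultimately show ?thesis by (simp add: hecke_act_def algebra_simps)
qed

lemma hecke_act_upd:
  fixes c e x y z
  defines "C \<equiv> \<lambda>x y z. c(e := x, Suc e := y, Suc (Suc e) := z)"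
  shows "hecke_act e v (C x y z) =
      (if x = y then - v (C x y z) else if x then - (q * v (C y x z))
       else (q - 1) * v (C x y z) - v (C y x z))"
    and "hecke_act (Suc e) v (C x y z) =
      (if y = z then - v (C x y z) else if y then - (q * v (C x z y))
       else (q - 1) * v (C x y z) - v (C x z y))"
proof -
  have "(C x y z)(e := a, Suc e := b) = C a b z" "(C x y z)(Suc e := a, Suc (Suc e) := b) = C x a b" for a b
    unfolding C_def by (simp_all add: fun_eq_iff)
  moreover have "C x y z e = x" "C x y z (Suc e) = y" "C x y z (Suc (Suc e)) = z"
    by (simp_all add: C_def)
  ultimately show "hecke_act e v (C x y z) =
      (if x = y then - v (C x y z) else if x then - (q * v (C y x z))
       else (q - 1) * v (C x y z) - v (C y x z))"
    "hecke_act (Suc e) v (C x y z) =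
      (if y = z then - v (C x y z) else if y then - (q * v (C x z y))
       else (q - 1) * v (C x y z) - v (C x z y))"
    unfolding hecke_act_def by auto
qed

text \<open>Among three positions two have the same colour, and two equal colours carry the sign
  character; hence the sum over a parabolic subgroup of type \<open>A\<^sub>2\<close> acts by zero.\<close>

lemma hecke_act_A2:
  "v c + hecke_act e v c + hecke_act (Suc e) v c + hecke_act (Suc e) (hecke_act e v) c
    + hecke_act e (hecke_act (Suc e) v) c + hecke_act e (hecke_act (Suc e) (hecke_act e v)) c = 0"
proof -
  define C where "C = (\<lambda>x y z. c(e := x, Suc e := y, Suc (Suc e) := z))"
  have upd: "hecke_act e v (C x y z) =
      (if x = y then - v (C x y z) else if x then - (q * v (C y x z))
       else (q - 1) * v (C x y z) - v (C y x z))"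
    "hecke_act (Suc e) v (C x y z) =
      (if y = z then - v (C x y z) else if y then - (q * v (C x z y))
       else (q - 1) * v (C x y z) - v (C x z y))" for v x y z
    unfolding C_def by (rule hecke_act_upd)+
  have "v (C x y z) + hecke_act e v (C x y z) + hecke_act (Suc e) v (C x y z)
      + hecke_act (Suc e) (hecke_act e v) (C x y z) + hecke_act e (hecke_act (Suc e) v) (C x y z)
      + hecke_act e (hecke_act (Suc e) (hecke_act e v)) (C x y z) = 0" for x y z
    by (cases x; cases y; cases z) (simp_all add: upd algebra_simps)
  from this[of "c e" "c (Suc e)" "c (Suc (Suc e))"] show ?thesis by (simp add: C_def)
qed

definition dominant :: "nat \<Rightarrow> colouring" where
  "dominant m x \<longleftrightarrow> 1 \<le> x \<and> x \<le> m"

text \<open>The image of the dominant colouring under \<open>T\<^sub>u\<close>: position \<open>p\<close> receives the colour of the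
  value \<open>u p\<close>. The sign accounts for both ways in which a generator can raise the length, since
  exchanging two values of the same colour and exchanging a dark with a light one both cost \<open>- 1\<close>.\<close>

definition colour_vec :: "nat \<Rightarrow> nat list \<Rightarrow> colouring \<Rightarrow> laurent" where
  "colour_vec m u c = (if c = dominant m \<circ> perm u then (- 1) ^ inv_count u else 0)"

lemma comp_adj_upd: "c \<circ> adj a = c(a := c (Suc a), Suc a := c a)"
  by (auto simp: transpose_def fun_eq_iff)

lemma eq_comp_adj_iff: "c = d \<circ> adj a \<longleftrightarrow> c \<circ> adj a = d"
proof
  assume "c \<circ> adj a = d"
  then have "d \<circ> adj a = c \<circ> (adj a \<circ> adj a)" by (simp only: comp_assoc[symmetric])
  then show "c = d \<circ> adj a" by simp
next
  assume "c = d \<circ> adj a"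
  then have "c \<circ> adj a = d \<circ> (adj a \<circ> adj a)" by (simp only: comp_assoc)
  then show "c \<circ> adj a = d" by simp
qed

text \<open>At an ascent the position \<open>a\<close> has the smaller value, so it cannot be light while \<open>a + 1\<close> is
  dark; this excludes the only case in which \<open>T\<^sub>a\<close> has more than one term.\<close>

lemma colour_vec_ascent:
  assumes "u \<in> cox_words n" "1 \<le> a" "perm u a < perm u (Suc a)" "a \<le> n"
  shows "hecke_act a (colour_vec m u) = colour_vec m (u @ [a])"
proof
  fix c
  define d where "d = dominant m \<circ> perm u"
  have sorted: "d a" if "d (Suc a)"
    using that assms perm_in_range(1)[of u n a] by (auto simp: d_def dominant_def)
  have vu: "colour_vec m u = (\<lambda>c. if c = d then (- 1) ^ inv_count u else 0)"
    by (simp add: colour_vec_def d_def fun_eq_iff)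
  have "colour_vec m (u @ [a]) c = (if c = d \<circ> adj a then - ((- 1) ^ inv_count u) else 0)"
    unfolding colour_vec_def inv_count_ascent[OF assms(3)] by (simp add: d_def comp_assoc)
  also have "\<dots> = (if c(a := c (Suc a), Suc a := c a) = d then - ((- 1) ^ inv_count u) else 0)"
    by (simp only: eq_comp_adj_iff[of c d a] comp_adj_upd[of c a])
  also have "\<dots> = hecke_act a (colour_vec m u) c"
  proof (cases "c a = c (Suc a)")
    case True
    then have "c(a := c (Suc a), Suc a := c a) = c" by (simp add: fun_eq_iff)
    then show ?thesis using True by (simp add: hecke_act_def vu)
  next
    case False
    show ?thesis
    proof (cases "c a")
      case True
      have "c(a := False, Suc a := True) \<noteq> d"
      proof
        assume "c(a := False, Suc a := True) = d"
        then have "d (Suc a)" "\<not> d a" by auto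
        with sorted show False by blast
      qed
      then show ?thesis using True False by (simp add: hecke_act_def vu)
    next
      case ca: False
      then have "c \<noteq> d" using sorted False by auto
      then show ?thesis using False ca by (simp add: hecke_act_def vu)
    qed
  qed
  finally show "hecke_act a (colour_vec m u) c = colour_vec m (u @ [a]) c" by simp
qed

lemma colour_vec_cong: "perm u = perm v \<Longrightarrow> colour_vec m u = colour_vec m v"
  by (rule ext) (simp add: colour_vec_def)

text \<open>A descent of \<open>u\<close> is an ascent of \<open>u s\<^sub>a\<close>; the quadratic relation does the rest.\<close>

lemma colour_vec_descent:
  assumes "u \<in> cox_words n" "1 \<le> a" "perm u (Suc a) < perm u a" "a \<le> n"
  shows "hecke_act a (colour_vec m u) c = q * colour_vec m (u @ [a]) c + (q - 1) * colour_vec m u c"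
proof -
  have "perm (u @ [a]) a < perm (u @ [a]) (Suc a)" using assms(3) by simp
  then have "hecke_act a (colour_vec m (u @ [a])) = colour_vec m ((u @ [a]) @ [a])"
    using assms by (intro colour_vec_ascent[of _ n]) auto
  also have "\<dots> = colour_vec m u"
    by (rule colour_vec_cong) (use perm_snoc_cancel[of u a] perm_snoc[of "u @ [a]" a] in simp)
  finally have "hecke_act a (colour_vec m (u @ [a])) = colour_vec m u" .
  then show ?thesis using hecke_act_quadratic[of a "colour_vec m (u @ [a])" c] by simp
qed

text \<open>Every word with finitely many dark positions is obtained from the one with all dark
  positions in front by moving dark positions to the right.\<close>

lemma dominant_transitive:
  assumes "S \<subseteq> {1..Suc n}"
  shows "\<exists>u\<in>cox_words n. dominant (card S) \<circ> perm u = (\<lambda>p. p \<in> S)"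
  using assms
proof (induction "\<Sum>S" arbitrary: S rule: less_induct)
  case less
  have fin: "finite S" using less.prems finite_subset by blast
  show ?case
  proof (cases "\<exists>b\<in>S. 2 \<le> b \<and> b - 1 \<notin> S")
    case True
    then obtain b where b: "b \<in> S" "2 \<le> b" "b - 1 \<notin> S" by blast
    define a where "a = b - 1"
    have a: "Suc a \<in> S" "1 \<le> a" "a \<notin> S" using b by (simp_all add: a_def)
    define S' where "S' = insert a (S - {Suc a})"
    have "\<Sum>S = Suc a + \<Sum>(S - {Suc a})" by (rule sum.remove[OF fin a(1)])
    moreover have "\<Sum>S' = a + \<Sum>(S - {Suc a})" unfolding S'_def using fin a by (subst sum.insert) auto
    ultimately have lt: "\<Sum>S' < \<Sum>S" by simp
    have card: "card S' = card S" unfolding S'_def using fin a card.remove[OF fin a(1)] by (subst card.insert) auto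
    have sub: "S' \<subseteq> {1..Suc n}" "a \<le> n" using less.prems a by (auto simp: S'_def)
    obtain u where u: "u \<in> cox_words n" "dominant (card S) \<circ> perm u = (\<lambda>p. p \<in> S')"
      using less.hyps[OF lt sub(1)] unfolding card by blast
    have "dominant (card S) \<circ> perm (u @ [a]) = (\<lambda>p. p \<in> S') \<circ> adj a"
      unfolding perm_snoc u(2)[symmetric] by (simp add: comp_assoc)
    also have "\<dots> = (\<lambda>p. p \<in> S)"
      unfolding comp_adj_upd using a by (auto simp: S'_def fun_eq_iff)
    finally show ?thesis using u(1) sub(2) a(2) by (intro bexI[of _ "u @ [a]"]) auto
  next
    case False
    then have down: "b - 1 \<in> S" if "b \<in> S" "2 \<le> b" for b using that by blast
    have lower: "b - t \<in> S" if "b \<in> S" "t < b" for b t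
      using that
    proof (induction t)
      case (Suc t)
      then show ?case using down[of "b - t"] by simp
    qed simp
    have "S = {1..card S}"
    proof (cases "S = {}")
      case False
      define M where "M = Max S"
      have M: "M \<in> S" "\<And>b. b \<in> S \<Longrightarrow> b \<le> M" using fin False by (auto simp: M_def)
      have "{1..M} \<subseteq> S"
      proof
        fix b
        assume "b \<in> {1..M}"
        then show "b \<in> S" using lower[OF M(1), of "M - b"] by simp
      qed
      moreover have "S \<subseteq> {1..M}" using M(2) less.prems by auto
      ultimately have "S = {1..M}" by (rule subset_antisym[rotated])
      then show ?thesis by simp
    qed simp
    then have "(p \<in> S) = (p \<in> {1..card S})" for p by (rule arg_cong)
    then have "dominant (card S) \<circ> perm [] = (\<lambda>p. p \<in> S)"
      by (simp add: dominant_def fun_eq_iff)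
    then show ?thesis by (intro bexI[of _ "[]"]) auto
  qed
qed

section \<open>Matrix coefficients of products over ascending runs\<close>

text \<open>The triple \<open>(\<alpha>, \<beta>, a)\<close> stands for the element \<open>\<alpha> T\<^sub>a + \<beta>\<close>. Letting the coefficients vary with
  the letter covers subwords and inverses at once.\<close>

definition factor_act ::
    "laurent \<times> laurent \<times> nat \<Rightarrow> (colouring \<Rightarrow> laurent) \<Rightarrow> colouring \<Rightarrow> laurent" where
  "factor_act = (\<lambda>(\<alpha>, \<beta>, a) v c. \<alpha> * hecke_act a v c + \<beta> * v c)"

definition factors_act ::
    "(laurent \<times> laurent \<times> nat) list \<Rightarrow> (colouring \<Rightarrow> laurent) \<Rightarrow> colouring \<Rightarrow> laurent" where
  "factors_act xs v = fold factor_act xs v"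

definition run_factors ::
    "(nat \<Rightarrow> laurent) \<Rightarrow> (nat \<Rightarrow> laurent) \<Rightarrow> nat \<Rightarrow> nat \<Rightarrow> (laurent \<times> laurent \<times> nat) list" where
  "run_factors \<alpha> \<beta> l m = map (\<lambda>a. (\<alpha> a, \<beta> a, a)) [l..<m]"

lemma run_factors_empty: "m \<le> l \<Longrightarrow> run_factors \<alpha> \<beta> l m = []"
  by (simp add: run_factors_def)

lemma run_factors_Suc: "l \<le> m \<Longrightarrow> run_factors \<alpha> \<beta> l (Suc m) = run_factors \<alpha> \<beta> l m @ [(\<alpha> m, \<beta> m, m)]"
  by (simp add: run_factors_def)

lemma factors_act_snoc: "factors_act (xs @ [x]) v = factor_act x (factors_act xs v)"
  by (simp add: factors_act_def)

lemma factors_act_append: "factors_act (xs @ ys) v = factors_act ys (factors_act xs v)"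
  by (simp add: factors_act_def)

definition colour_unit :: "nat set \<Rightarrow> colouring \<Rightarrow> laurent" where
  "colour_unit S c = (if c = (\<lambda>p. p \<in> S) then 1 else 0)"

text \<open>An ascending run can carry a dark position from one end to the other only by swapping at
  each letter.\<close>

lemma transport_run:
  fixes \<alpha> \<beta> :: "nat \<Rightarrow> laurent"
  assumes "i \<le> m" "\<And>p. p \<in> U \<Longrightarrow> p < i"
  defines "v \<equiv> \<lambda>m. factors_act (run_factors \<alpha> \<beta> i m) (colour_unit (insert i U))"
  shows "(c m \<longrightarrow> v m c = (\<Prod>b\<in>{i..<m}. - \<alpha> b) * colour_unit (insert m U) c) \<and>
    (\<forall>p>m. c p \<longrightarrow> v m c = 0)"
  using assms(1)
proof (induction m arbitrary: c rule: dec_induct)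
  case base
  have "c \<noteq> (\<lambda>p. p \<in> insert i U)" if "i < p" "c p" for p
    using that assms(2)[of p] by force
  then show ?case by (auto simp: v_def run_factors_empty factors_act_def colour_unit_def)
next
  case (step m)
  have v: "v (Suc m) c = \<alpha> m * hecke_act m (v m) c + \<beta> m * v m c" for c
    using step.hyps by (simp add: v_def run_factors_Suc factors_act_snoc factor_act_def)
  have m: "m \<notin> U" "Suc m \<notin> U" using assms(2) step.hyps by force+
  have zero: "v m c = 0" if "m < p" "c p" for p c using step.IH that by blast
  show ?case
  proof (intro conjI impI allI)
    assume c: "c (Suc m)"
    show "v (Suc m) c = (\<Prod>b\<in>{i..<Suc m}. - \<alpha> b) * colour_unit (insert (Suc m) U) c"
    proof (cases "c m")
      case True
      then have "c \<noteq> (\<lambda>p. p \<in> insert (Suc m) U)" using m by auto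
      then show ?thesis using True c by (simp add: v hecke_act_def zero[of "Suc m"] colour_unit_def)
    next
      case False
      let ?c = "c(m := True, Suc m := False)"
      have "v m ?c = (\<Prod>b\<in>{i..<m}. - \<alpha> b) * colour_unit (insert m U) ?c"
        using step.IH[of ?c] fun_upd_same[of c] by (metis fun_upd_other n_not_Suc_n)
      moreover have "?c = (\<lambda>p. p \<in> insert m U) \<longleftrightarrow> c = (\<lambda>p. p \<in> insert (Suc m) U)"
        using False c m by (auto simp: fun_eq_iff split: if_splits)
      then have "colour_unit (insert m U) ?c = colour_unit (insert (Suc m) U) c"
        by (simp add: colour_unit_def)
      ultimately show ?thesis using False c step.hyps
        by (simp add: v hecke_act_def zero[of "Suc m"])
    qed
  next
    fix p
    assume p: "Suc m < p" "c p"
    then show "v (Suc m) c = 0" by (simp add: v hecke_act_def zero[of p])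
  qed
qed

definition diagonal_entry :: "bool \<Rightarrow> bool \<Rightarrow> laurent" where
  "diagonal_entry x y = (if x = y then - 1 else if x then 0 else q - 1)"

text \<open>A swap at the letter \<open>b\<close> of an ascending run changes the number of dark positions up to \<open>b\<close>,
  and no later letter can undo this: diagonal coefficients are products of diagonal entries.\<close>

lemma stationary_run:
  fixes \<alpha> \<beta> :: "nat \<Rightarrow> laurent" and v :: "colouring \<Rightarrow> laurent"
  assumes "l \<le> m" "m < z" "d z"
    and v: "\<And>c. c z \<Longrightarrow> v c = (if c = d then \<kappa> else 0)"
  defines "w \<equiv> \<lambda>m. factors_act (run_factors \<alpha> \<beta> l m) v"
  shows "w m d = \<kappa> * (\<Prod>b\<in>{l..<m}. \<alpha> b * diagonal_entry (d b) (d (Suc b)) + \<beta> b) \<and>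
    (\<forall>c p. c z \<and> m < p \<and> c p \<noteq> d p \<longrightarrow> w m c = 0)"
  using assms(1,2)
proof (induction m rule: dec_induct)
  case base
  then show ?case using assms(3) by (auto simp: w_def run_factors_empty factors_act_def v)
next
  case (step m)
  have w: "w (Suc m) c = \<alpha> m * hecke_act m (w m) c + \<beta> m * w m c" for c
    using step.hyps by (simp add: w_def run_factors_Suc factors_act_snoc factor_act_def)
  have zero: "w m c = 0" if "c z" "m < p" "c p \<noteq> d p" for c p using step that by auto
  have "hecke_act m (w m) d = diagonal_entry (d m) (d (Suc m)) * w m d"
  proof -
    have off: "w m (d(m := x, Suc m := y)) = 0" if "y \<noteq> d (Suc m)" for x y
      using that step.prems assms(3) by (intro zero[of _ "Suc m"]) auto
    show ?thesis
      using off[where x = True and y = False] off[where x = False and y = True]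
      by (auto simp: hecke_act_def diagonal_entry_def)
  qed
  moreover have "w m d = \<kappa> * (\<Prod>b\<in>{l..<m}. \<alpha> b * diagonal_entry (d b) (d (Suc b)) + \<beta> b)"
    using step by simp
  ultimately have "w (Suc m) d =
      \<kappa> * (\<Prod>b\<in>{l..<Suc m}. \<alpha> b * diagonal_entry (d b) (d (Suc b)) + \<beta> b)"
    using step.hyps by (simp add: w algebra_simps)
  moreover have "w (Suc m) c = 0" if "c z" "Suc m < p" "c p \<noteq> d p" for c p
    using that step.prems by (simp add: w hecke_act_def zero[of _ p])
  ultimately show ?case by blast
qed

lemma two_run_coefficient:
  assumes "l \<le> i" "i \<le> m" "U \<subseteq> {l..<i}"
  shows "factors_act (run_factors \<alpha> \<beta> i (Suc m) @ run_factors \<alpha>' \<beta>' l m)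
      (colour_unit (insert i U)) (\<lambda>p. p \<in> insert (Suc m) U) =
    (\<Prod>b\<in>{i..<Suc m}. - \<alpha> b) *
    (\<Prod>b\<in>{l..<i}. \<alpha>' b * diagonal_entry (b \<in> U) (Suc b \<in> U) + \<beta>' b) *
    (\<Prod>b\<in>{i..<m}. \<beta>' b - \<alpha>' b)"
proof -
  let ?d = "\<lambda>p. p \<in> insert (Suc m) U"
  let ?v = "factors_act (run_factors \<alpha> \<beta> i (Suc m)) (colour_unit (insert i U))"
  let ?\<kappa> = "\<Prod>b\<in>{i..<Suc m}. - \<alpha> b"
  have v: "?v c = (if c = ?d then ?\<kappa> else 0)" if "c (Suc m)" for c
    using transport_run[of i "Suc m" U c \<alpha> \<beta>] that assms by (force simp: colour_unit_def)
  let ?f = "\<lambda>b. \<alpha>' b * diagonal_entry (?d b) (?d (Suc b)) + \<beta>' b"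
  have "factors_act (run_factors \<alpha>' \<beta>' l m) ?v ?d = ?\<kappa> * (\<Prod>b\<in>{l..<m}. ?f b)"
    using stationary_run[of l m "Suc m" ?d ?v ?\<kappa> \<alpha>' \<beta>'] v assms by simp
  also have "(\<Prod>b\<in>{l..<m}. ?f b) = (\<Prod>b\<in>{l..<i}. ?f b) * (\<Prod>b\<in>{i..<m}. ?f b)"
    using assms by (simp add: prod.atLeastLessThan_concat)
  also have "(\<Prod>b\<in>{l..<i}. ?f b) =
      (\<Prod>b\<in>{l..<i}. \<alpha>' b * diagonal_entry (b \<in> U) (Suc b \<in> U) + \<beta>' b)"
    using assms by (intro prod.cong) auto
  also have "(\<Prod>b\<in>{i..<m}. ?f b) = (\<Prod>b\<in>{i..<m}. \<beta>' b - \<alpha>' b)"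
    using assms by (intro prod.cong) (auto simp: diagonal_entry_def)
  finally show ?thesis by (simp add: factors_act_append mult.assoc)
qed

text \<open>For each colour \<open>y\<close> of the right neighbour these are the two weights with sum \<open>1\<close> that make the
  weighted sum of the diagonal entries zero.\<close>

definition trace_weight :: "bool \<Rightarrow> bool \<Rightarrow> laurent" where
  "trace_weight x y = (if y then q_inv * (if x then q - 1 else 1) else if x then 1 else 0)"

lemma trace_weight_sum:
  "trace_weight True y * (\<alpha> * diagonal_entry True y + \<beta>) +
   trace_weight False y * (\<alpha> * diagonal_entry False y + \<beta>) = \<beta>"
  by (cases y) (simp_all add: trace_weight_def diagonal_entry_def algebra_simps)

text \<open>Summing over the colour of the lowest position first turns its factor into \<open>\<beta>\<^sub>l\<close>, whatever the
  colour of the next position, so the sum factorises.\<close>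

lemma weighted_diagonal_sum:
  assumes "l \<le> i"
  shows "(\<Sum>U\<in>Pow {l..<i}. (\<Prod>b\<in>{l..<i}. trace_weight (b \<in> U) (Suc b \<in> U)) *
      (\<Prod>b\<in>{l..<i}. \<alpha> b * diagonal_entry (b \<in> U) (Suc b \<in> U) + \<beta> b)) = (\<Prod>b\<in>{l..<i}. \<beta> b)"
  using assms
proof (induction l rule: inc_induct)
  case base
  show ?case by simp
next
  case (step l)
  define f where "f = (\<lambda>b x y. trace_weight x y * (\<alpha> b * diagonal_entry x y + \<beta> b))"
  define A where "A = {Suc l..<i}"
  have ins: "{l..<i} = insert l A" "l \<notin> A" "finite A" using step.hyps by (auto simp: A_def)
  have F: "(\<Prod>b\<in>A. f b (b \<in> U) (Suc b \<in> U)) = (\<Prod>b\<in>A. f b (b \<in> insert l U) (Suc b \<in> insert l U))" for U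
    by (intro prod.cong) (auto simp: A_def)
  have "(\<Sum>U\<in>Pow (insert l A). \<Prod>b\<in>insert l A. f b (b \<in> U) (Suc b \<in> U)) =
    (\<Sum>U\<in>Pow A. \<Prod>b\<in>insert l A. f b (b \<in> U) (Suc b \<in> U)) +
    (\<Sum>U\<in>insert l ` Pow A. \<Prod>b\<in>insert l A. f b (b \<in> U) (Suc b \<in> U))"
    unfolding Pow_insert using ins by (intro sum.union_disjoint) auto
  also have "(\<Sum>U\<in>insert l ` Pow A. \<Prod>b\<in>insert l A. f b (b \<in> U) (Suc b \<in> U)) =
    (\<Sum>U\<in>Pow A. \<Prod>b\<in>insert l A. f b (b \<in> insert l U) (Suc b \<in> insert l U))"
    using ins by (subst sum.reindex) (auto intro!: inj_onI)
  also have "(\<Sum>U\<in>Pow A. \<Prod>b\<in>insert l A. f b (b \<in> U) (Suc b \<in> U)) + \<dots> =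
    (\<Sum>U\<in>Pow A. \<beta> l * (\<Prod>b\<in>A. f b (b \<in> U) (Suc b \<in> U)))"
    unfolding sum.distrib[symmetric]
  proof (intro sum.cong refl)
    fix U
    assume "U \<in> Pow A"
    then have "l \<notin> U" using ins by auto
    then have "(\<Prod>b\<in>insert l A. f b (b \<in> U) (Suc b \<in> U)) +
        (\<Prod>b\<in>insert l A. f b (b \<in> insert l U) (Suc b \<in> insert l U)) =
      (f l True (Suc l \<in> U) + f l False (Suc l \<in> U)) * (\<Prod>b\<in>A. f b (b \<in> U) (Suc b \<in> U))"
      unfolding prod.insert[OF ins(3,2)] F[symmetric] by (simp add: algebra_simps)
    then show "(\<Prod>b\<in>insert l A. f b (b \<in> U) (Suc b \<in> U)) +
        (\<Prod>b\<in>insert l A. f b (b \<in> insert l U) (Suc b \<in> insert l U)) =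
      \<beta> l * (\<Prod>b\<in>A. f b (b \<in> U) (Suc b \<in> U))"
      unfolding f_def trace_weight_sum .
  qed
  also have "\<dots> = \<beta> l * (\<Prod>b\<in>A. \<beta> b)"
    unfolding A_def f_def prod.distrib sum_distrib_left[symmetric] step.IH ..
  also have "\<dots> = (\<Prod>b\<in>{l..<i}. \<beta> b)" unfolding ins(1) prod.insert[OF ins(3,2)] ..
  finally show ?case unfolding ins(1) f_def prod.distrib .
qed

section \<open>Linear forms on the Hecke algebra\<close>

lemma laurent_ring_simps [simp]:
  "carrier laurent_ring = UNIV" "x \<oplus>\<^bsub>laurent_ring\<^esub> y = x + y" "x \<otimes>\<^bsub>laurent_ring\<^esub> y = x * y"
  "\<one>\<^bsub>laurent_ring\<^esub> = 1" "\<zero>\<^bsub>laurent_ring\<^esub> = 0"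
  by (simp_all add: laurent_ring_def)

lemma cox_gen_eq: "cox_gen n a = cox_elem n [a]"
  by (simp add: cox_gen_def)

lemma hecke_act_zero: "hecke_act a (\<lambda>c. 0) = (\<lambda>c. 0)"
  by (simp add: hecke_act_def fun_eq_iff)

lemma factors_act_zero: "factors_act xs (\<lambda>c. 0) = (\<lambda>c. 0)"
  by (induction xs) (auto simp: factors_act_def factor_act_def hecke_act_zero)

lemma (in abelian_monoid) finsum_singleton_swap:
  assumes "i \<in> A" "finite A" "f \<in> A \<rightarrow> carrier G"
  shows "(\<Oplus>j\<in>A. if j = i then f j else \<zero>) = f i"
  using add.finprod_singleton_swap[of i A f] assms by (simp add: finsum_def)

context hecke_algebra
begin

text \<open>Inside the locale the unqualified ring laws speak of the scalars; those of the algebra are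
  given names here.\<close>

lemma ring_H: "ring H"
  using hecke_algebra_axioms by (simp add: hecke_algebra_def)

lemma abelian_monoid_H: "abelian_monoid H"
  using ring.is_abelian_group[OF ring_H] by (simp add: abelian_group_def)

lemmas H_m_assoc = ring.ring_simprules(11)[OF ring_H]
  and H_l_distr = ring.ring_simprules(13)[OF ring_H]
  and H_r_distr = ring.ring_simprules(23)[OF ring_H]
  and H_finsum_cong = abelian_monoid.finsum_cong'[OF abelian_monoid_H]
  and H_finsum_insert = abelian_monoid.finsum_insert[OF abelian_monoid_H]
  and H_finsum_add = abelian_monoid.finsum_addf[OF abelian_monoid_H]
  and H_finsum_singleton = abelian_monoid.finsum_singleton_swap[OF abelian_monoid_H]

lemma smult_in: "x \<in> carrier H \<Longrightarrow> c \<odot>\<^bsub>H\<^esub> x \<in> carrier H"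
  by (rule smult_closed) simp_all

lemma smult_add: "x \<in> carrier H \<Longrightarrow> (a + b) \<odot>\<^bsub>H\<^esub> x = a \<odot>\<^bsub>H\<^esub> x \<oplus>\<^bsub>H\<^esub> b \<odot>\<^bsub>H\<^esub> x"
  using smult_l_distr[of a b x] by simp

lemma smult_smult: "x \<in> carrier H \<Longrightarrow> a \<odot>\<^bsub>H\<^esub> (b \<odot>\<^bsub>H\<^esub> x) = (a * b) \<odot>\<^bsub>H\<^esub> x"
  using smult_assoc1[of a b x] by simp

lemma smult_add_right:
  "x \<in> carrier H \<Longrightarrow> y \<in> carrier H \<Longrightarrow> a \<odot>\<^bsub>H\<^esub> (x \<oplus>\<^bsub>H\<^esub> y) = a \<odot>\<^bsub>H\<^esub> x \<oplus>\<^bsub>H\<^esub> a \<odot>\<^bsub>H\<^esub> y"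
  using smult_r_distr[of a x y] by simp

lemma smult_1: "x \<in> carrier H \<Longrightarrow> 1 \<odot>\<^bsub>H\<^esub> x = x"
  using smult_one[of x] by simp

lemma smult_0: "x \<in> carrier H \<Longrightarrow> 0 \<odot>\<^bsub>H\<^esub> x = \<zero>\<^bsub>H\<^esub>"
  using smult_l_null[of x] by simp

definition coef :: "'h \<Rightarrow> nat list set \<Rightarrow> laurent" where
  "coef h = (THE c. c \<in> carrier (coxA n) \<rightarrow>\<^sub>E UNIV \<and>
     h = (\<Oplus>\<^bsub>H\<^esub>w\<in>carrier (coxA n). c w \<odot>\<^bsub>H\<^esub> T w))"

lemma coef_expansion:
  assumes "h \<in> carrier H"
  shows "h = (\<Oplus>\<^bsub>H\<^esub>w\<in>carrier (coxA n). coef h w \<odot>\<^bsub>H\<^esub> T w)"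
  using theI'[OF T_basis[OF assms]] unfolding coef_def by blast

lemma coef_eqI:
  assumes "h \<in> carrier H" "h = (\<Oplus>\<^bsub>H\<^esub>w\<in>carrier (coxA n). c w \<odot>\<^bsub>H\<^esub> T w)" "w \<in> carrier (coxA n)"
  shows "coef h w = c w"
proof -
  let ?c = "restrict c (carrier (coxA n))"
  have "h = (\<Oplus>\<^bsub>H\<^esub>w\<in>carrier (coxA n). ?c w \<odot>\<^bsub>H\<^esub> T w)"
    unfolding assms(2) by (intro H_finsum_cong) (auto intro: smult_in T_closed)
  then have "coef h = ?c"
    unfolding coef_def by (intro the1_equality[OF T_basis[OF assms(1)]]) auto
  then show ?thesis using assms(3) by simp
qed

definition linear_form :: "('h \<Rightarrow> laurent) \<Rightarrow> bool" where
  "linear_form F \<longleftrightarrow> (\<forall>x\<in>carrier H. \<forall>y\<in>carrier H. F (x \<oplus>\<^bsub>H\<^esub> y) = F x + F y) \<and>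
     (\<forall>c. \<forall>x\<in>carrier H. F (c \<odot>\<^bsub>H\<^esub> x) = c * F x)"

lemma linear_form_add:
  "linear_form F \<Longrightarrow> x \<in> carrier H \<Longrightarrow> y \<in> carrier H \<Longrightarrow> F (x \<oplus>\<^bsub>H\<^esub> y) = F x + F y"
  by (simp add: linear_form_def)

lemma linear_form_smult: "linear_form F \<Longrightarrow> x \<in> carrier H \<Longrightarrow> F (c \<odot>\<^bsub>H\<^esub> x) = c * F x"
  by (simp add: linear_form_def)

lemma linear_form_zero: "linear_form F \<Longrightarrow> F \<zero>\<^bsub>H\<^esub> = 0"
  using linear_form_smult[of F "\<zero>\<^bsub>H\<^esub>" 0] smult_0[of "\<zero>\<^bsub>H\<^esub>"] by simp

lemma linear_form_finsum:
  assumes "linear_form F" "finite A" "g \<in> A \<rightarrow> carrier H"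
  shows "F (\<Oplus>\<^bsub>H\<^esub>x\<in>A. g x) = (\<Sum>x\<in>A. F (g x))"
  using assms(2,3)
proof (induction A)
  case empty
  then show ?case by (simp add: linear_form_zero[OF assms(1)])
next
  case (insert x A)
  then have "(\<Oplus>\<^bsub>H\<^esub>y\<in>insert x A. g y) = g x \<oplus>\<^bsub>H\<^esub> (\<Oplus>\<^bsub>H\<^esub>y\<in>A. g y)"
    by (intro H_finsum_insert) auto
  then show ?case using insert linear_form_add[OF assms(1)] by (simp add: Pi_iff)
qed

lemma linear_form_eqI:
  assumes "linear_form F" "linear_form G" "\<And>w. w \<in> carrier (coxA n) \<Longrightarrow> F (T w) = G (T w)"
    and "h \<in> carrier H"
  shows "F h = G h"
proof -
  have expand: "K h = (\<Sum>w\<in>carrier (coxA n). coef h w * K (T w))" if "linear_form K" for K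
  proof -
    have "K h = K (\<Oplus>\<^bsub>H\<^esub>w\<in>carrier (coxA n). coef h w \<odot>\<^bsub>H\<^esub> T w)"
      using coef_expansion[OF assms(4)] by simp
    also have "\<dots> = (\<Sum>w\<in>carrier (coxA n). K (coef h w \<odot>\<^bsub>H\<^esub> T w))"
      using that finite_carrier_coxA by (intro linear_form_finsum) (auto intro: smult_in T_closed)
    finally show ?thesis using linear_form_smult[OF that] T_closed by simp
  qed
  show ?thesis unfolding expand[OF assms(1)] expand[OF assms(2)] using assms(3) by simp
qed

definition linear_extension :: "(nat list set \<Rightarrow> laurent) \<Rightarrow> 'h \<Rightarrow> laurent" where
  "linear_extension f h = (\<Sum>w\<in>carrier (coxA n). coef h w * f w)"

lemma linear_form_extension: "linear_form (linear_extension f)"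
proof -
  let ?W = "carrier (coxA n)"
  have Pi: "(\<lambda>w. c w \<odot>\<^bsub>H\<^esub> T w) \<in> ?W \<rightarrow> carrier H" for c by (auto intro: smult_in T_closed)
  have "coef (x \<oplus>\<^bsub>H\<^esub> y) w = coef x w + coef y w"
    if x: "x \<in> carrier H" and y: "y \<in> carrier H" and w: "w \<in> ?W" for x y w
  proof (rule coef_eqI[OF _ _ w])
    show "x \<oplus>\<^bsub>H\<^esub> y = (\<Oplus>\<^bsub>H\<^esub>w\<in>?W. (coef x w + coef y w) \<odot>\<^bsub>H\<^esub> T w)"
    proof -
      have "x \<oplus>\<^bsub>H\<^esub> y = (\<Oplus>\<^bsub>H\<^esub>w\<in>?W. coef x w \<odot>\<^bsub>H\<^esub> T w) \<oplus>\<^bsub>H\<^esub> (\<Oplus>\<^bsub>H\<^esub>w\<in>?W. coef y w \<odot>\<^bsub>H\<^esub> T w)"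
        using coef_expansion[OF x] coef_expansion[OF y] by simp
      also have "\<dots> = (\<Oplus>\<^bsub>H\<^esub>w\<in>?W. coef x w \<odot>\<^bsub>H\<^esub> T w \<oplus>\<^bsub>H\<^esub> coef y w \<odot>\<^bsub>H\<^esub> T w)"
        using Pi by (intro H_finsum_add[symmetric])
      also have "\<dots> = (\<Oplus>\<^bsub>H\<^esub>w\<in>?W. (coef x w + coef y w) \<odot>\<^bsub>H\<^esub> T w)"
        by (intro H_finsum_cong) (auto simp: smult_add T_closed intro: smult_in)
      finally show ?thesis .
    qed
  qed (use x y in simp)
  moreover have "coef (c \<odot>\<^bsub>H\<^esub> x) w = c * coef x w" if x: "x \<in> carrier H" and w: "w \<in> ?W" for x w c
  proof (rule coef_eqI[OF _ _ w])
    show "c \<odot>\<^bsub>H\<^esub> x = (\<Oplus>\<^bsub>H\<^esub>w\<in>?W. (c * coef x w) \<odot>\<^bsub>H\<^esub> T w)"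
    proof -
      have "c \<odot>\<^bsub>H\<^esub> x = c \<odot>\<^bsub>H\<^esub> (\<Oplus>\<^bsub>H\<^esub>w\<in>?W. coef x w \<odot>\<^bsub>H\<^esub> T w)"
        using coef_expansion[OF x] by simp
      also have "\<dots> = (\<Oplus>\<^bsub>H\<^esub>w\<in>?W. c \<odot>\<^bsub>H\<^esub> (coef x w \<odot>\<^bsub>H\<^esub> T w))"
        using Pi finite_carrier_coxA by (intro finsum_smult_ldistr) auto
      also have "\<dots> = (\<Oplus>\<^bsub>H\<^esub>w\<in>?W. (c * coef x w) \<odot>\<^bsub>H\<^esub> T w)"
        by (intro H_finsum_cong) (auto simp: smult_smult T_closed intro: smult_in)
      finally show ?thesis .
    qed
  qed (use x smult_in in simp)
  ultimately show ?thesis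
    by (simp add: linear_form_def linear_extension_def sum.distrib algebra_simps sum_distrib_left)
qed

lemma linear_extension_T:
  assumes "w \<in> carrier (coxA n)"
  shows "linear_extension f (T w) = f w"
proof -
  let ?W = "carrier (coxA n)"
  have "(\<Oplus>\<^bsub>H\<^esub>v\<in>?W. (if v = w then 1 else 0) \<odot>\<^bsub>H\<^esub> T v) = (\<Oplus>\<^bsub>H\<^esub>v\<in>?W. if v = w then T v else \<zero>\<^bsub>H\<^esub>)"
    by (intro H_finsum_cong) (auto simp: smult_1 smult_0 T_closed)
  also have "\<dots> = T w"
    using assms finite_carrier_coxA T_closed by (intro H_finsum_singleton) auto
  finally have "coef (T w) v = (if v = w then 1 else 0)" if "v \<in> ?W" for v
    using that assms T_closed by (intro coef_eqI) auto
  then have "linear_extension f (T w) = (\<Sum>v\<in>?W. if v = w then f v else 0)"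
    unfolding linear_extension_def by (intro sum.cong) auto
  then show ?thesis using assms finite_carrier_coxA by simp
qed

lemma linear_form_comp_mult:
  assumes "linear_form F" "y \<in> carrier H"
  shows "linear_form (\<lambda>x. F (x \<otimes>\<^bsub>H\<^esub> y))" "linear_form (\<lambda>x. F (y \<otimes>\<^bsub>H\<^esub> x))"
  using assms by (auto simp: linear_form_def H_l_distr H_r_distr smult_mult_left smult_mult_right smult_in)

section \<open>The Hecke algebra acting on two-coloured words\<close>

definition colour_map :: "nat \<Rightarrow> 'h \<Rightarrow> colouring \<Rightarrow> laurent" where
  "colour_map m h c = linear_extension
     (\<lambda>w. colour_vec m (SOME u. u \<in> cox_words n \<and> cox_elem n u = w) c) h"

lemma linear_form_colour_map: "linear_form (\<lambda>h. colour_map m h c)"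
  unfolding colour_map_def by (rule linear_form_extension)

lemma colour_map_T:
  assumes "u \<in> cox_words n"
  shows "colour_map m (T (cox_elem n u)) = colour_vec m u"
proof
  fix c
  let ?v = "SOME v. v \<in> cox_words n \<and> cox_elem n v = cox_elem n u"
  have "?v \<in> cox_words n \<and> cox_elem n ?v = cox_elem n u"
    by (rule someI_ex) (use assms in blast)
  then have "perm ?v = perm u" using assms cox_elem_eq_iff by blast
  then have "colour_vec m ?v = colour_vec m u" by (rule colour_vec_cong)
  then show "colour_map m (T (cox_elem n u)) c = colour_vec m u c"
    unfolding colour_map_def using assms by (subst linear_extension_T) (auto simp: carrier_coxA)
qed

lemma cox_gen_in: "a \<in> {1..n} \<Longrightarrow> cox_gen n a \<in> carrier (coxA n)"
  by (simp add: cox_gen_eq carrier_coxA)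

lemma T_gen_in: "a \<in> {1..n} \<Longrightarrow> T (cox_gen n a) \<in> carrier H"
  by (intro T_closed cox_gen_in)

lemma T_snoc_ascent:
  assumes "u \<in> cox_words n" "a \<in> {1..n}" "perm u a < perm u (Suc a)"
  shows "T (cox_elem n u) \<otimes>\<^bsub>H\<^esub> T (cox_gen n a) = T (cox_elem n (u @ [a]))"
proof -
  have e: "cox_elem n u \<otimes>\<^bsub>coxA n\<^esub> cox_gen n a = cox_elem n (u @ [a])"
    using assms by (simp add: cox_gen_eq mult_coxA)
  have "cox_length (cox_elem n u) < cox_length (cox_elem n (u @ [a]))"
    using assms inv_count_ascent[OF assms(3)] by (simp add: cox_length_eq_inv_count del: perm_append)
  then show ?thesis
    using T_mult_up[of "cox_elem n u" a] assms unfolding e by (simp add: carrier_coxA)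
qed

lemma T_snoc_descent:
  assumes "u \<in> cox_words n" "a \<in> {1..n}" "perm u (Suc a) < perm u a"
  shows "T (cox_elem n u) \<otimes>\<^bsub>H\<^esub> T (cox_gen n a) =
    q \<odot>\<^bsub>H\<^esub> T (cox_elem n (u @ [a])) \<oplus>\<^bsub>H\<^esub> (q - 1) \<odot>\<^bsub>H\<^esub> T (cox_elem n u)"
proof -
  have e: "cox_elem n u \<otimes>\<^bsub>coxA n\<^esub> cox_gen n a = cox_elem n (u @ [a])"
    using assms by (simp add: cox_gen_eq mult_coxA)
  have "cox_length (cox_elem n (u @ [a])) < cox_length (cox_elem n u)"
    using assms inv_count_descent[OF assms(3)] by (simp add: cox_length_eq_inv_count del: perm_append)
  then show ?thesis
    using T_mult_down[of "cox_elem n u" a] assms unfolding e by (simp add: carrier_coxA)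
qed

text \<open>The map is equivariant because, on the basis, the behaviour of coloured words at ascents and
  descents matches the two multiplication rules of the algebra.\<close>

lemma colour_map_mult_gen:
  assumes "h \<in> carrier H" "a \<in> {1..n}"
  shows "colour_map m (h \<otimes>\<^bsub>H\<^esub> T (cox_gen n a)) = hecke_act a (colour_map m h)"
proof
  fix c
  note lin = linear_form_colour_map[of m]
  have "linear_form (\<lambda>h. hecke_act a (colour_map m h) c)"
    unfolding linear_form_def hecke_act_def
    by (auto simp: linear_form_add[OF lin] linear_form_smult[OF lin] algebra_simps)
  moreover have "colour_map m (T w \<otimes>\<^bsub>H\<^esub> T (cox_gen n a)) c = hecke_act a (colour_map m (T w)) c"
    if "w \<in> carrier (coxA n)" for w
  proof -
    obtain u where u: "u \<in> cox_words n" "w = cox_elem n u" using \<open>w \<in> _\<close> by (auto simp: carrier_coxA)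
    have ua: "u @ [a] \<in> cox_words n" using u assms by simp
    have Tin: "T (cox_elem n u) \<in> carrier H" "T (cox_elem n (u @ [a])) \<in> carrier H"
      using u ua by (auto intro!: T_closed simp: carrier_coxA)
    show ?thesis
    proof (cases "perm u a < perm u (Suc a)")
      case True
      have "colour_map m (T w \<otimes>\<^bsub>H\<^esub> T (cox_gen n a)) = colour_vec m (u @ [a])"
        unfolding u(2) T_snoc_ascent[OF u(1) assms(2) True] by (rule colour_map_T[OF ua])
      also have "\<dots> = hecke_act a (colour_vec m u)"
        using colour_vec_ascent[OF u(1) _ True] assms(2) by simp
      finally show ?thesis unfolding u(2) colour_map_T[OF u(1)] by simp
    next
      case False
      then have desc: "perm u (Suc a) < perm u a" using ascent_or_descent by blast
      have "colour_map m (T w \<otimes>\<^bsub>H\<^esub> T (cox_gen n a)) c =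
          q * colour_vec m (u @ [a]) c + (q - 1) * colour_vec m u c"
        unfolding u(2) T_snoc_descent[OF u(1) assms(2) desc]
        by (simp only: linear_form_add[OF lin] linear_form_smult[OF lin] smult_in Tin
            colour_map_T[OF ua] colour_map_T[OF u(1)])
      also have "\<dots> = hecke_act a (colour_vec m u) c"
        using assms(2) by (intro colour_vec_descent[OF u(1) _ desc, symmetric]) auto
      finally show ?thesis unfolding u(2) colour_map_T[OF u(1)] .
    qed
  qed
  ultimately show "colour_map m (h \<otimes>\<^bsub>H\<^esub> T (cox_gen n a)) c = hecke_act a (colour_map m h) c"
    by (rule linear_form_eqI[of "\<lambda>h. colour_map m (h \<otimes>\<^bsub>H\<^esub> T (cox_gen n a)) c"
          "\<lambda>h. hecke_act a (colour_map m h) c", rotated])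
      (assumption | rule assms(1) linear_form_comp_mult(1)[OF lin T_gen_in[OF assms(2)]])+
qed

definition factor :: "laurent \<times> laurent \<times> nat \<Rightarrow> 'h" where
  "factor = (\<lambda>(\<alpha>, \<beta>, a). \<alpha> \<odot>\<^bsub>H\<^esub> T (cox_gen n a) \<oplus>\<^bsub>H\<^esub> \<beta> \<odot>\<^bsub>H\<^esub> \<one>\<^bsub>H\<^esub>)"

definition factors :: "(laurent \<times> laurent \<times> nat) list \<Rightarrow> 'h" where
  "factors xs = foldr (\<lambda>x h. factor x \<otimes>\<^bsub>H\<^esub> h) xs \<one>\<^bsub>H\<^esub>"

definition letters_ok :: "(laurent \<times> laurent \<times> nat) list \<Rightarrow> bool" where
  "letters_ok xs \<longleftrightarrow> (\<forall>(\<alpha>, \<beta>, a)\<in>set xs. a \<in> {1..n})"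

lemma letters_ok_simps [simp]:
  "letters_ok []" "letters_ok ((\<alpha>, \<beta>, a) # xs) \<longleftrightarrow> a \<in> {1..n} \<and> letters_ok xs"
  "letters_ok (xs @ ys) \<longleftrightarrow> letters_ok xs \<and> letters_ok ys"
  by (simp_all add: letters_ok_def ball_Un)

lemma factor_in: "a \<in> {1..n} \<Longrightarrow> factor (\<alpha>, \<beta>, a) \<in> carrier H"
  unfolding factor_def by (simp add: smult_in T_gen_in)

lemma factors_Nil [simp]: "factors [] = \<one>\<^bsub>H\<^esub>"
  and factors_Cons: "factors (x # xs) = factor x \<otimes>\<^bsub>H\<^esub> factors xs"
  by (simp_all add: factors_def)

lemma factors_in: "letters_ok xs \<Longrightarrow> factors xs \<in> carrier H"
proof (induction xs)
  case (Cons x xs)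
  obtain \<alpha> \<beta> a where "x = (\<alpha>, \<beta>, a)" by (cases x) auto
  with Cons show ?case by (simp add: factors_Cons factor_in)
qed simp

lemma factors_append:
  "letters_ok xs \<Longrightarrow> letters_ok ys \<Longrightarrow> factors (xs @ ys) = factors xs \<otimes>\<^bsub>H\<^esub> factors ys"
proof (induction xs)
  case (Cons x xs)
  obtain \<alpha> \<beta> a where "x = (\<alpha>, \<beta>, a)" by (cases x) auto
  with Cons show ?case by (simp add: factors_Cons factor_in factors_in H_m_assoc)
qed (simp add: factors_in)

lemma colour_map_factors:
  assumes "letters_ok xs" "h \<in> carrier H"
  shows "colour_map m (h \<otimes>\<^bsub>H\<^esub> factors xs) = factors_act xs (colour_map m h)"
  using assms
proof (induction xs arbitrary: h)
  case Nil
  then show ?case by (simp add: factors_act_def)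
next
  case (Cons x xs)
  obtain \<alpha> \<beta> a where x: "x = (\<alpha>, \<beta>, a)" by (cases x) auto
  have a: "a \<in> {1..n}" and xs: "letters_ok xs" using Cons.prems x by auto
  note lin = linear_form_colour_map[of m]
  have "h \<otimes>\<^bsub>H\<^esub> factor x = \<alpha> \<odot>\<^bsub>H\<^esub> (h \<otimes>\<^bsub>H\<^esub> T (cox_gen n a)) \<oplus>\<^bsub>H\<^esub> \<beta> \<odot>\<^bsub>H\<^esub> h"
    using Cons.prems(2) T_gen_in[OF a]
    by (simp add: x factor_def H_r_distr smult_in smult_mult_right)
  then have "colour_map m (h \<otimes>\<^bsub>H\<^esub> factor x) = factor_act x (colour_map m h)"
    using Cons.prems(2) T_gen_in[OF a]
    by (intro ext) (simp add: linear_form_add[OF lin] linear_form_smult[OF lin] smult_in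
        colour_map_mult_gen[OF _ a] factor_act_def x)
  moreover have "h \<otimes>\<^bsub>H\<^esub> factors (x # xs) = (h \<otimes>\<^bsub>H\<^esub> factor x) \<otimes>\<^bsub>H\<^esub> factors xs"
    using Cons.prems factors_in[OF xs] factor_in[OF a] by (simp add: factors_Cons x H_m_assoc)
  ultimately show ?case
    using Cons.IH[OF xs, of "h \<otimes>\<^bsub>H\<^esub> factor x"] Cons.prems(2) factor_in[OF a]
    by (simp add: factors_act_def x)
qed

definition word_factors :: "nat list \<Rightarrow> (laurent \<times> laurent \<times> nat) list" where
  "word_factors u = map (\<lambda>a. (1, 0, a)) u"

lemma letters_ok_word: "u \<in> cox_words n \<Longrightarrow> letters_ok (word_factors u)"
  by (auto simp: letters_ok_def word_factors_def cox_words_def)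

lemma factor_gen: "a \<in> {1..n} \<Longrightarrow> factor (1, 0, a) = T (cox_gen n a)"
  unfolding factor_def by (simp add: smult_1 smult_0 T_gen_in)

lemma T_reduced:
  assumes "u \<in> cox_words n" "reduced u"
  shows "T (cox_elem n u) = factors (word_factors u)"
  using assms
proof (induction u rule: rev_induct)
  case Nil
  then show ?case using T_one by (simp add: one_coxA word_factors_def)
next
  case (snoc a u)
  have u: "u \<in> cox_words n" "a \<in> {1..n}" using snoc.prems by auto
  note red = reduced_snocD[OF snoc.prems(2)]
  have "T (cox_elem n (u @ [a])) = T (cox_elem n u) \<otimes>\<^bsub>H\<^esub> T (cox_gen n a)"
    by (rule T_snoc_ascent[OF u red(2), symmetric])
  also have "\<dots> = factors (word_factors u) \<otimes>\<^bsub>H\<^esub> factors (word_factors [a])"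
    unfolding snoc.IH[OF u(1) red(1)] using u T_gen_in
    by (simp add: word_factors_def factors_Cons factor_gen)
  also have "\<dots> = factors (word_factors (u @ [a]))"
    using letters_ok_word[OF u(1)] letters_ok_word[of "[a]"] u(2)
    by (subst factors_append[symmetric]) (auto simp: word_factors_def)
  finally show ?case .
qed

lemma T_has_reduced_word:
  assumes "w \<in> carrier (coxA n)"
  obtains u where "u \<in> cox_words n" "w = cox_elem n u" "reduced u"
proof -
  obtain u where u: "u \<in> cox_words n" "w = cox_elem n u" using assms by (auto simp: carrier_coxA)
  obtain v where v: "(u, v) \<in> cox_rel n" "length v = inv_count u"
    using exists_word_of_length_inv_count[OF u(1)] by blast
  have "v \<in> cox_words n" "perm u = perm v" using cox_rel_words[OF v(1)] perm_cong[OF v(1)] by auto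
  then show thesis using that[of v] u v(2) cox_elem_eq_iff[of u n v] by simp
qed

end

section \<open>Vanishing on the Temperley-Lieb ideal\<close>

text \<open>The reduced words of the six elements of \<open>\<langle>s\<^sub>e, s\<^bsub>e+1\<^esub>\<rangle>\<close>.\<close>

definition A2_words :: "nat \<Rightarrow> nat list list" where
  "A2_words e = [[], [e], [Suc e], [e, Suc e], [Suc e, e], [e, Suc e, e]]"

lemma A2_words_reduced:
  assumes "u \<in> set (A2_words e)"
  shows "reduced u"
proof -
  have 1: "reduced [a]" for a using inv_count_ascent[of "[]" a] by simp
  have 2: "reduced [e, Suc e]" "reduced [Suc e, e]"
    using inv_count_ascent[of "[e]" "Suc e"] inv_count_ascent[of "[Suc e]" e] 1[of e] 1[of "Suc e"]
    by (simp_all add: transpose_def)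
  have 3: "reduced [e, Suc e, e]"
    using inv_count_ascent[of "[e, Suc e]" e] 2(1) by (simp add: transpose_def)
  show ?thesis using assms 1 2 3 by (auto simp only: A2_words_def set_simps insert_iff empty_iff
        list.size perm_Nil inversions_id card.empty)
qed

lemma A2_words_perm_inj: "inj_on perm (set (A2_words e))"
proof (rule inj_onI)
  fix u v
  assume uv: "u \<in> set (A2_words e)" "v \<in> set (A2_words e)" and "perm u = perm v"
  then have "perm u e = perm v e" "perm u (Suc e) = perm v (Suc e)" by simp_all
  then show "u = v" using uv by (auto simp: A2_words_def transpose_def)
qed

lemma A2_words_closed:
  assumes "a = e \<or> a = Suc e" "u \<in> set (A2_words e)"
  shows "\<exists>v\<in>set (A2_words e). perm v = perm (a # u)"
proof -
  have square: "adj a \<circ> (adj a \<circ> p) = p" for a and p :: "nat \<Rightarrow> nat"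
    by (simp add: fun_eq_iff)
  have braid: "adj (Suc e) \<circ> (adj e \<circ> (adj (Suc e) \<circ> p)) = adj e \<circ> (adj (Suc e) \<circ> (adj e \<circ> p))"
    for p :: "nat \<Rightarrow> nat"
    by (rule ext) (simp add: transpose_def)
  \<comment> \<open>\<open>w\<close> and \<open>w'\<close> are the words of the left multiples by \<open>s\<^sub>e\<close> and by \<open>s\<^bsub>e+1\<^esub>\<close>.\<close>
  have witness: ?thesis
    if "w \<in> set (A2_words e)" "w' \<in> set (A2_words e)"
      "perm w = perm (e # u)" "perm w' = perm (Suc e # u)" for w w'
    using that assms(1) by blast
  consider "u = []" | "u = [e]" | "u = [Suc e]" | "u = [e, Suc e]" | "u = [Suc e, e]"
    | "u = [e, Suc e, e]"
    using assms(2) by (auto simp: A2_words_def)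
  then show ?thesis
  proof cases
    case 1
    then show ?thesis
      by (intro witness[of "[e]" "[Suc e]"])
        (simp_all only: perm_Nil perm_Cons square braid, simp_all add: A2_words_def)
  next
    case 2
    then show ?thesis
      by (intro witness[of "[]" "[Suc e, e]"])
        (simp_all only: perm_Nil perm_Cons square braid, simp_all add: A2_words_def)
  next
    case 3
    then show ?thesis
      by (intro witness[of "[e, Suc e]" "[]"])
        (simp_all only: perm_Nil perm_Cons square braid, simp_all add: A2_words_def)
  next
    case 4
    then show ?thesis
      by (intro witness[of "[Suc e]" "[e, Suc e, e]"])
        (simp_all only: perm_Nil perm_Cons square braid, simp_all add: A2_words_def)
  next
    case 5
    then show ?thesis
      by (intro witness[of "[e, Suc e, e]" "[e]"])
        (simp_all only: perm_Nil perm_Cons square braid, simp_all add: A2_words_def)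
  next
    case 6
    then show ?thesis
      by (intro witness[of "[Suc e, e]" "[e, Suc e]"])
        (simp_all only: perm_Nil perm_Cons square braid, simp_all add: A2_words_def)
  qed
qed

lemma generate_A2:
  assumes "e \<in> {1..n}" "Suc e \<in> {1..n}"
  shows "generate (coxA n) {cox_gen n e, cox_gen n (Suc e)} = cox_elem n ` set (A2_words e)"
    (is "?G = ?S")
proof
  interpret group "coxA n" by (rule group_coxA)
  have words: "set (A2_words e) \<subseteq> cox_words n" using assms by (auto simp: A2_words_def)
  have gens: "{cox_gen n e, cox_gen n (Suc e)} \<subseteq> carrier (coxA n)"
    using assms by (auto simp: cox_gen_eq carrier_coxA)
  have S: "y \<in> carrier (coxA n)" if "y \<in> ?S" for y using that words by (auto simp: carrier_coxA)
  have step: "h \<otimes>\<^bsub>coxA n\<^esub> y \<in> ?S" if h: "h \<in> {cox_gen n e, cox_gen n (Suc e)}" and y: "y \<in> ?S" for h y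
  proof -
    obtain a where a: "a = e \<or> a = Suc e" "h = cox_elem n [a]" using h by (auto simp: cox_gen_eq)
    obtain u where u: "u \<in> set (A2_words e)" "y = cox_elem n u" using y by auto
    have w: "[a] \<in> cox_words n" "u \<in> cox_words n" using a u words assms by auto
    obtain v where v: "v \<in> set (A2_words e)" "perm v = perm (a # u)"
      using A2_words_closed[OF a(1) u(1)] by blast
    have "h \<otimes>\<^bsub>coxA n\<^esub> y = cox_elem n (a # u)" unfolding a(2) u(2) mult_coxA[OF w] by simp
    also have "\<dots> = cox_elem n v"
      using w v words by (subst cox_elem_eq_iff) (auto simp del: perm_Cons)
    finally show ?thesis using v(1) by simp
  qed
  show "?G \<subseteq> ?S"
  proof
    fix x
    assume x: "x \<in> ?G"
    then have "\<forall>y\<in>?S. x \<otimes>\<^bsub>coxA n\<^esub> y \<in> ?S"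
    proof induction
      case one
      then show ?case using S by auto
    next
      case (incl h)
      then show ?case using step by blast
    next
      case (inv h)
      then have "inv\<^bsub>coxA n\<^esub> h = h" using assms by (auto simp: cox_gen_eq inv_coxA)
      then show ?case using step inv by simp
    next
      case (eng h1 h2)
      show ?case
      proof
        fix y
        assume y: "y \<in> ?S"
        have eq: "h1 \<otimes>\<^bsub>coxA n\<^esub> h2 \<otimes>\<^bsub>coxA n\<^esub> y = h1 \<otimes>\<^bsub>coxA n\<^esub> (h2 \<otimes>\<^bsub>coxA n\<^esub> y)"
          using eng.hyps y S generate_in_carrier[OF gens] by (intro m_assoc) auto
        show "h1 \<otimes>\<^bsub>coxA n\<^esub> h2 \<otimes>\<^bsub>coxA n\<^esub> y \<in> ?S"
          unfolding eq using eng.IH y by blast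
      qed
    qed
    moreover have "\<one>\<^bsub>coxA n\<^esub> \<in> ?S" by (simp add: one_coxA A2_words_def)
    ultimately have "x \<otimes>\<^bsub>coxA n\<^esub> \<one>\<^bsub>coxA n\<^esub> \<in> ?S" by blast
    then show "x \<in> ?S" using generate_in_carrier[OF gens x] by simp
  qed
  have g: "cox_elem n [e] \<in> ?G" "cox_elem n [Suc e] \<in> ?G"
    by (auto simp: cox_gen_eq[symmetric] intro: generate.incl)
  have "cox_elem n [] \<in> ?G" using generate.one by (simp add: one_coxA[symmetric])
  moreover have "cox_elem n [e, Suc e] \<in> ?G"
    using generate.eng[OF g(1) g(2)] assms by (simp add: mult_coxA)
  moreover have ef: "cox_elem n [Suc e, e] \<in> ?G"
    using generate.eng[OF g(2) g(1)] assms by (simp add: mult_coxA)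
  moreover have "cox_elem n [e, Suc e, e] \<in> ?G"
    using generate.eng[OF g(1) ef] assms by (simp add: mult_coxA)
  ultimately show "?S \<subseteq> ?G" using g by (auto simp: A2_words_def)
qed

lemma noncommuting_gens_adjacent:
  assumes "a \<in> {1..n}" "b \<in> {1..n}"
    and "cox_gen n a \<otimes>\<^bsub>coxA n\<^esub> cox_gen n b \<noteq> cox_gen n b \<otimes>\<^bsub>coxA n\<^esub> cox_gen n a"
  shows "b = Suc a \<or> a = Suc b"
proof (rule ccontr)
  assume "\<not> (b = Suc a \<or> a = Suc b)"
  then consider "a = b" | "cox_m a b = 2" by (cases "a = b") (simp_all add: cox_m_def)
  then have "perm [a, b] = perm [b, a]"
    by cases (simp, rule perm_cong[OF cox_rel_commute[OF assms(1,2)]])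
  then have "cox_elem n [a, b] = cox_elem n [b, a]"
    using assms(1,2) by (subst cox_elem_eq_iff) (simp_all del: perm_Cons)
  then show False using assms by (simp add: cox_gen_eq mult_coxA)
qed

context hecke_algebra
begin

text \<open>Quantifying over left multipliers makes the common kernel of the colour maps a two-sided
  ideal.\<close>

definition killed :: "'h set" where
  "killed = {h \<in> carrier H. \<forall>m. \<forall>c. \<forall>g\<in>carrier H. colour_map m (g \<otimes>\<^bsub>H\<^esub> h) c = 0}"

text \<open>The kernel of an equivariant map is closed under right multiplication, as every \<open>T\<^sub>w\<close> is a
  product of generators.\<close>

lemma colour_map_mult_zero:
  assumes "g \<in> carrier H" "x \<in> carrier H" "colour_map m g = (\<lambda>c. 0)"
  shows "colour_map m (g \<otimes>\<^bsub>H\<^esub> x) c = 0"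
proof -
  have T0: "colour_map m (g \<otimes>\<^bsub>H\<^esub> T w) c = 0" if "w \<in> carrier (coxA n)" for w
  proof -
    obtain u where u: "u \<in> cox_words n" "w = cox_elem n u" "reduced u"
      using T_has_reduced_word[OF \<open>w \<in> _\<close>] by blast
    show ?thesis
      unfolding u(2) T_reduced[OF u(1,3)] colour_map_factors[OF letters_ok_word[OF u(1)] assms(1)]
      by (simp add: assms(3) factors_act_zero)
  qed
  have "linear_form (\<lambda>h. 0)" by (simp add: linear_form_def)
  then show ?thesis
    using linear_form_eqI[of "\<lambda>x. colour_map m (g \<otimes>\<^bsub>H\<^esub> x) c" "\<lambda>h. 0" x]
      linear_form_comp_mult(2)[OF linear_form_colour_map assms(1)] T0 assms(2) by simp
qed

lemma ideal_killed: "ideal killed H"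
proof (rule idealI[OF ring_H])
  note lin = linear_form_colour_map
  show "subgroup killed (add_monoid H)"
  proof (rule subgroup.intro)
    show "inv\<^bsub>add_monoid H\<^esub> x \<in> killed" if "x \<in> killed" for x
    proof -
      have x: "x \<in> carrier H" "\<And>m g c. g \<in> carrier H \<Longrightarrow> colour_map m (g \<otimes>\<^bsub>H\<^esub> x) c = 0"
        using that by (auto simp: killed_def)
      have nx: "\<ominus>\<^bsub>H\<^esub> x \<in> carrier H" using x(1) by (rule ring.ring_simprules(3)[OF ring_H])
      have "colour_map m (g \<otimes>\<^bsub>H\<^esub> \<ominus>\<^bsub>H\<^esub> x) c = 0" if g: "g \<in> carrier H" for m g c
      proof -
        note lin' = linear_form_comp_mult(2)[OF lin g]
        have "colour_map m (g \<otimes>\<^bsub>H\<^esub> (x \<oplus>\<^bsub>H\<^esub> \<ominus>\<^bsub>H\<^esub> x)) c = 0"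
          using ring.ring_simprules(16)[OF ring_H x(1)] linear_form_zero[OF lin'] by simp
        then show ?thesis using linear_form_add[OF lin' x(1) nx] x(2)[OF g] by simp
      qed
      then show ?thesis using nx by (simp add: killed_def a_inv_def[symmetric])
    qed
    show "\<one>\<^bsub>add_monoid H\<^esub> \<in> killed"
      using linear_form_zero[OF linear_form_comp_mult(2)[OF lin]] by (simp add: killed_def)
    show "x \<otimes>\<^bsub>add_monoid H\<^esub> y \<in> killed" if "x \<in> killed" "y \<in> killed" for x y
      using that linear_form_add[OF linear_form_comp_mult(2)[OF lin]] by (simp add: killed_def)
  qed (auto simp: killed_def)
next
  fix h x
  assume h: "h \<in> killed" and x: "x \<in> carrier H"
  have hc: "h \<in> carrier H" using h by (simp add: killed_def)
  show "x \<otimes>\<^bsub>H\<^esub> h \<in> killed"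
    using h x by (auto simp: killed_def H_m_assoc[symmetric])
  have "colour_map m (g \<otimes>\<^bsub>H\<^esub> (h \<otimes>\<^bsub>H\<^esub> x)) c = 0" if g: "g \<in> carrier H" for g m c
  proof -
    have "colour_map m (g \<otimes>\<^bsub>H\<^esub> h) = (\<lambda>c. 0)" using h g by (auto simp: killed_def)
    then show ?thesis
      using colour_map_mult_zero[of "g \<otimes>\<^bsub>H\<^esub> h" x] g hc x by (simp add: H_m_assoc)
  qed
  then show "h \<otimes>\<^bsub>H\<^esub> x \<in> killed" using hc x by (simp add: killed_def)
qed

definition A2_sum :: "nat \<Rightarrow> nat \<Rightarrow> 'h" where
  "A2_sum a b = (\<Oplus>\<^bsub>H\<^esub>w\<in>generate (coxA n) {cox_gen n a, cox_gen n b}. T w)"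

text \<open>Along the six reduced words the action adds up to the expression that vanishes on all
  colourings.\<close>

lemma A2_sum_killed:
  assumes "e \<in> {1..n}" "Suc e \<in> {1..n}"
  shows "A2_sum e (Suc e) \<in> killed"
proof -
  let ?W = "set (A2_words e)"
  have words: "u \<in> cox_words n" if "u \<in> ?W" for u using that assms by (auto simp: A2_words_def)
  have sum: "A2_sum e (Suc e) = (\<Oplus>\<^bsub>H\<^esub>w\<in>cox_elem n ` ?W. T w)"
    unfolding A2_sum_def generate_A2[OF assms] ..
  have Tc: "T \<in> cox_elem n ` ?W \<rightarrow> carrier H" using words by (auto intro!: T_closed simp: carrier_coxA)
  have closed: "A2_sum e (Suc e) \<in> carrier H"
    unfolding sum using Tc by (rule abelian_monoid.finsum_closed[OF abelian_monoid_H])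
  have inj: "inj_on (cox_elem n) ?W"
    using words cox_elem_eq_iff A2_words_perm_inj[of e] unfolding inj_on_def by blast
  have "colour_map m (g \<otimes>\<^bsub>H\<^esub> A2_sum e (Suc e)) c = 0" if g: "g \<in> carrier H" for m g c
  proof -
    let ?v = "colour_map m g"
    have "colour_map m (g \<otimes>\<^bsub>H\<^esub> A2_sum e (Suc e)) c = (\<Sum>w\<in>cox_elem n ` ?W. colour_map m (g \<otimes>\<^bsub>H\<^esub> T w) c)"
      unfolding sum
      using Tc by (intro linear_form_finsum[OF linear_form_comp_mult(2)[OF linear_form_colour_map g]]) auto
    also have "\<dots> = (\<Sum>u\<in>?W. colour_map m (g \<otimes>\<^bsub>H\<^esub> T (cox_elem n u)) c)"
      by (subst sum.reindex[OF inj]) simp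
    also have "\<dots> = (\<Sum>u\<in>?W. factors_act (word_factors u) ?v c)"
      using words A2_words_reduced g
      by (intro sum.cong refl) (simp only: T_reduced colour_map_factors letters_ok_word)
    also have "\<dots> = ?v c + hecke_act e ?v c + hecke_act (Suc e) ?v c + hecke_act (Suc e) (hecke_act e ?v) c
        + hecke_act e (hecke_act (Suc e) ?v) c + hecke_act e (hecke_act (Suc e) (hecke_act e ?v)) c"
      by (simp add: A2_words_def factors_act_def word_factors_def factor_act_def add.assoc)
    also have "\<dots> = 0" by (rule hecke_act_A2)
    finally show ?thesis .
  qed
  then show ?thesis using closed by (simp add: killed_def)
qed

definition TL_relations :: "'h set" where
  "TL_relations = {A2_sum a b | a b. a \<in> {1..n} \<and> b \<in> {1..n} \<and>
     cox_gen n a \<otimes>\<^bsub>coxA n\<^esub> cox_gen n b \<noteq> cox_gen n b \<otimes>\<^bsub>coxA n\<^esub> cox_gen n a}"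

lemma TL_ideal_eq: "TL_ideal n H T = Idl\<^bsub>H\<^esub> TL_relations"
  by (simp add: TL_ideal_def TL_relations_def A2_sum_def)

lemma TL_relations_killed: "TL_relations \<subseteq> killed"
proof
  fix x
  assume "x \<in> TL_relations"
  then obtain a b where ab: "x = A2_sum a b" "a \<in> {1..n}" "b \<in> {1..n}"
    "cox_gen n a \<otimes>\<^bsub>coxA n\<^esub> cox_gen n b \<noteq> cox_gen n b \<otimes>\<^bsub>coxA n\<^esub> cox_gen n a"
    by (auto simp: TL_relations_def)
  have "A2_sum a b = A2_sum b a" by (simp add: A2_sum_def insert_commute)
  then show "x \<in> killed"
    using noncommuting_gens_adjacent[OF ab(2-4)] A2_sum_killed ab(1-3) by metis
qed

lemma TL_ideal_ideal: "ideal (TL_ideal n H T) H"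
  unfolding TL_ideal_eq using TL_relations_killed
  by (intro ring.genideal_ideal[OF ring_H]) (auto simp: killed_def)

lemma TL_ideal_killed: "TL_ideal n H T \<subseteq> killed"
  unfolding TL_ideal_eq by (rule ring.genideal_minimal[OF ring_H ideal_killed TL_relations_killed])

section \<open>A linear form on the Temperley-Lieb algebra\<close>

definition TL_form :: "('h \<Rightarrow> laurent) \<Rightarrow> bool" where
  "TL_form F \<longleftrightarrow> linear_form F \<and> (\<forall>h\<in>TL_ideal n H T. F h = 0)"

lemma factors_act_scale: "factors_act xs (\<lambda>c. s * v c) = (\<lambda>c. s * factors_act xs v c)"
proof (induction xs arbitrary: v)
  case (Cons x xs)
  have "factor_act x (\<lambda>c. s * v c) = (\<lambda>c. s * factor_act x v c)"
    by (auto simp: factor_act_def hecke_act_def fun_eq_iff algebra_simps split: prod.splits)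
  then show ?case using Cons by (simp add: factors_act_def)
qed (simp add: factors_act_def)

text \<open>The colour maps start from dominant colourings only; multiplying from the left by a suitable
  \<open>T\<^sub>u\<close> lets a matrix coefficient start from any finite set of dark positions.\<close>

lemma matrix_coefficient_form:
  assumes "S \<subseteq> {1..Suc n}"
  shows "\<exists>F. TL_form F \<and> (\<forall>xs. letters_ok xs \<longrightarrow> F (factors xs) = factors_act xs (colour_unit S) c)"
proof -
  obtain u where u: "u \<in> cox_words n" "dominant (card S) \<circ> perm u = (\<lambda>p. p \<in> S)"
    using dominant_transitive[OF assms] by blast
  let ?s = "(- 1) ^ inv_count u :: laurent"
  let ?t = "T (cox_elem n u)"
  define F where "F = (\<lambda>h. ?s * colour_map (card S) (?t \<otimes>\<^bsub>H\<^esub> h) c)"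
  have t: "?t \<in> carrier H" using u by (auto intro: T_closed simp: carrier_coxA)
  note lin = linear_form_comp_mult(2)[OF linear_form_colour_map t]
  have vec: "colour_vec (card S) u = (\<lambda>c. ?s * colour_unit S c)"
    unfolding colour_vec_def u(2) colour_unit_def by (simp add: fun_eq_iff)
  have "linear_form F"
    unfolding F_def using lin by (simp add: linear_form_def algebra_simps)
  moreover have "F h = 0" if "h \<in> TL_ideal n H T" for h
    using that TL_ideal_killed t by (auto simp: F_def killed_def)
  moreover have "F (factors xs) = factors_act xs (colour_unit S) c" if "letters_ok xs" for xs
  proof -
    have "F (factors xs) = ?s * (?s * factors_act xs (colour_unit S) c)"
      unfolding F_def colour_map_factors[OF that t] colour_map_T[OF u(1)] vec factors_act_scale ..
    also have "?s * (?s * factors_act xs (colour_unit S) c) = factors_act xs (colour_unit S) c"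
      by (simp add: mult.assoc[symmetric] power_mult_distrib[symmetric])
    finally show ?thesis .
  qed
  ultimately show ?thesis unfolding TL_form_def by blast
qed

lemma letters_ok_run: "1 \<le> l \<Longrightarrow> m \<le> Suc n \<Longrightarrow> letters_ok (run_factors \<alpha> \<beta> l m)"
  by (auto simp: letters_ok_def run_factors_def)

lemma two_run_form:
  assumes "1 \<le> l" "l \<le> i" "i \<le> m" "m \<le> n"
  shows "\<exists>F. TL_form F \<and> (\<forall>\<alpha> \<beta> \<alpha>' \<beta>'.
    F (factors (run_factors \<alpha> \<beta> i (Suc m) @ run_factors \<alpha>' \<beta>' l m)) =
      (\<Prod>b\<in>{i..<Suc m}. - \<alpha> b) * (\<Prod>b\<in>{l..<i}. \<beta>' b) * (\<Prod>b\<in>{i..<m}. \<beta>' b - \<alpha>' b))"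
proof -
  have "\<forall>U\<in>Pow {l..<i}. \<exists>F. TL_form F \<and> (\<forall>xs. letters_ok xs \<longrightarrow>
    F (factors xs) = factors_act xs (colour_unit (insert i U)) (\<lambda>p. p \<in> insert (Suc m) U))"
  proof
    fix U
    assume "U \<in> Pow {l..<i}"
    then have "insert i U \<subseteq> {1..Suc n}" using assms by auto
    then show "\<exists>F. TL_form F \<and> (\<forall>xs. letters_ok xs \<longrightarrow>
      F (factors xs) = factors_act xs (colour_unit (insert i U)) (\<lambda>p. p \<in> insert (Suc m) U))"
      by (rule matrix_coefficient_form)
  qed
  from bchoice[OF this] obtain F where FF: "\<forall>U\<in>Pow {l..<i}. TL_form (F U) \<and> (\<forall>xs. letters_ok xs \<longrightarrow>
      F U (factors xs) = factors_act xs (colour_unit (insert i U)) (\<lambda>p. p \<in> insert (Suc m) U))" ..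
  then have F: "\<And>U. U \<in> Pow {l..<i} \<Longrightarrow> TL_form (F U)"
    "\<And>U xs. U \<in> Pow {l..<i} \<Longrightarrow> letters_ok xs \<Longrightarrow>
      F U (factors xs) = factors_act xs (colour_unit (insert i U)) (\<lambda>p. p \<in> insert (Suc m) U)"
    by simp_all
  define w where "w = (\<lambda>U. \<Prod>b\<in>{l..<i}. trace_weight (b \<in> U) (Suc b \<in> U))"
  define G where "G = (\<lambda>h. \<Sum>U\<in>Pow {l..<i}. w U * F U h)"
  have "TL_form G"
    using F(1) unfolding TL_form_def linear_form_def G_def
    by (simp add: sum.distrib algebra_simps sum_distrib_left)
  moreover have "G (factors (run_factors \<alpha> \<beta> i (Suc m) @ run_factors \<alpha>' \<beta>' l m)) =
      (\<Prod>b\<in>{i..<Suc m}. - \<alpha> b) * (\<Prod>b\<in>{l..<i}. \<beta>' b) * (\<Prod>b\<in>{i..<m}. \<beta>' b - \<alpha>' b)"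
    (is "G (factors ?xs) = ?A * _ * ?C") for \<alpha> \<beta> \<alpha>' \<beta>'
  proof -
    have ok: "letters_ok ?xs" using assms by (simp add: letters_ok_run)
    have "G (factors ?xs) = (\<Sum>U\<in>Pow {l..<i}. ?A * ?C *
        (w U * (\<Prod>b\<in>{l..<i}. \<alpha>' b * diagonal_entry (b \<in> U) (Suc b \<in> U) + \<beta>' b)))"
      unfolding G_def
    proof (intro sum.cong refl)
      fix U
      assume U: "U \<in> Pow {l..<i}"
      show "w U * F U (factors ?xs) = ?A * ?C *
        (w U * (\<Prod>b\<in>{l..<i}. \<alpha>' b * diagonal_entry (b \<in> U) (Suc b \<in> U) + \<beta>' b))"
        unfolding F(2)[OF U ok] two_run_coefficient[OF assms(2,3) PowD[OF U]]
        by (simp only: mult_ac)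
    qed
    also have "\<dots> = ?A * ?C * (\<Prod>b\<in>{l..<i}. \<beta>' b)"
      unfolding sum_distrib_left[symmetric] w_def weighted_diagonal_sum[OF assms(2)] ..
    finally show ?thesis by (simp only: mult_ac)
  qed
  ultimately show ?thesis by blast
qed

end

section \<open>Inverses in the Temperley-Lieb algebra\<close>

lemma perm_rev: "u \<in> cox_words n \<Longrightarrow> perm (rev u) = inv_into UNIV (perm u)"
  using perm_comp_rev[of u n] perm_comp_rev[of "rev u" n] by (intro inv_unique_comp[symmetric]) auto

lemma inv_count_rev_le:
  assumes "u \<in> cox_words n"
  shows "inv_count (rev u) \<le> inv_count u"
proof -
  obtain v where v: "(u, v) \<in> cox_rel n" "length v = inv_count u"
    using exists_word_of_length_inv_count[OF assms] by blast
  have "perm (rev u) = perm (rev v)"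
    using perm_cong[OF v(1)] cox_rel_words[OF v(1)] by (simp add: perm_rev[of _ n])
  then show ?thesis using inv_count_le_length[of "rev v"] v(2) by simp
qed

lemma reduced_rev:
  assumes "u \<in> cox_words n" "reduced u"
  shows "reduced (rev u)"
proof -
  have "inv_count (rev u) = inv_count u"
    using inv_count_rev_le[OF assms(1)] inv_count_rev_le[of "rev u" n] assms(1) by simp
  then show ?thesis using assms(2) by simp
qed

lemma (in ideal) rcos_eqI:
  assumes "y \<in> I +> x" "x \<in> carrier R"
  shows "I +> y = I +> x"
  using a_repr_independence'[OF assms] by simp

context hecke_algebra
begin

definition inverse_factors :: "nat list \<Rightarrow> (laurent \<times> laurent \<times> nat) list" where
  "inverse_factors u = map (\<lambda>a. (q_inv, q_inv * (1 - q), a)) u"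

lemma letters_ok_inverse: "u \<in> cox_words n \<Longrightarrow> letters_ok (inverse_factors u)"
  by (auto simp: letters_ok_def inverse_factors_def cox_words_def)

lemma T_gen_square:
  assumes "a \<in> {1..n}"
  shows "T (cox_gen n a) \<otimes>\<^bsub>H\<^esub> T (cox_gen n a) = q \<odot>\<^bsub>H\<^esub> \<one>\<^bsub>H\<^esub> \<oplus>\<^bsub>H\<^esub> (q - 1) \<odot>\<^bsub>H\<^esub> T (cox_gen n a)"
proof -
  have "cox_elem n ([a] @ [a]) = cox_elem n []" using assms by (subst cox_elem_eq_iff) auto
  then have "T (cox_elem n ([a] @ [a])) = \<one>\<^bsub>H\<^esub>" using T_one by (simp add: one_coxA)
  moreover have "T (cox_elem n [a]) \<otimes>\<^bsub>H\<^esub> T (cox_gen n a) =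
      q \<odot>\<^bsub>H\<^esub> T (cox_elem n ([a] @ [a])) \<oplus>\<^bsub>H\<^esub> (q - 1) \<odot>\<^bsub>H\<^esub> T (cox_elem n [a])"
    using assms by (intro T_snoc_descent) simp_all
  ultimately show ?thesis by (simp only: cox_gen_eq)
qed

lemma inverse_gen:
  assumes "a \<in> {1..n}"
  shows "T (cox_gen n a) \<otimes>\<^bsub>H\<^esub> factor (q_inv, q_inv * (1 - q), a) = \<one>\<^bsub>H\<^esub>"
    and "factor (q_inv, q_inv * (1 - q), a) \<otimes>\<^bsub>H\<^esub> T (cox_gen n a) = \<one>\<^bsub>H\<^esub>"
proof -
  let ?t = "T (cox_gen n a)"
  have t: "?t \<in> carrier H" by (rule T_gen_in[OF assms])
  have one: "\<one>\<^bsub>H\<^esub> \<in> carrier H" by (rule ring.ring_simprules(6)[OF ring_H])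
  let ?e = "q_inv \<odot>\<^bsub>H\<^esub> (?t \<otimes>\<^bsub>H\<^esub> ?t) \<oplus>\<^bsub>H\<^esub> (q_inv * (1 - q)) \<odot>\<^bsub>H\<^esub> ?t"
  have "?e = (\<one>\<^bsub>H\<^esub> \<oplus>\<^bsub>H\<^esub> (q_inv * (q - 1)) \<odot>\<^bsub>H\<^esub> ?t) \<oplus>\<^bsub>H\<^esub> (q_inv * (1 - q)) \<odot>\<^bsub>H\<^esub> ?t"
    unfolding T_gen_square[OF assms] using t one
    by (simp add: smult_add_right smult_in smult_smult smult_1)
  also have "\<dots> = \<one>\<^bsub>H\<^esub> \<oplus>\<^bsub>H\<^esub> ((q_inv * (q - 1)) \<odot>\<^bsub>H\<^esub> ?t \<oplus>\<^bsub>H\<^esub> (q_inv * (1 - q)) \<odot>\<^bsub>H\<^esub> ?t)"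
    using t one by (intro ring.ring_simprules(7)[OF ring_H]) (auto intro: smult_in)
  also have "(q_inv * (q - 1)) \<odot>\<^bsub>H\<^esub> ?t \<oplus>\<^bsub>H\<^esub> (q_inv * (1 - q)) \<odot>\<^bsub>H\<^esub> ?t = \<zero>\<^bsub>H\<^esub>"
    unfolding smult_add[OF t, symmetric] using smult_0[OF t] by (simp add: algebra_simps)
  also have "\<one>\<^bsub>H\<^esub> \<oplus>\<^bsub>H\<^esub> \<zero>\<^bsub>H\<^esub> = \<one>\<^bsub>H\<^esub>" by (rule ring.ring_simprules(15)[OF ring_H one])
  finally have e: "?e = \<one>\<^bsub>H\<^esub>" .
  show "?t \<otimes>\<^bsub>H\<^esub> factor (q_inv, q_inv * (1 - q), a) = \<one>\<^bsub>H\<^esub>"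
    unfolding factor_def using t one e by (simp add: H_r_distr smult_in smult_mult_right)
  show "factor (q_inv, q_inv * (1 - q), a) \<otimes>\<^bsub>H\<^esub> ?t = \<one>\<^bsub>H\<^esub>"
    unfolding factor_def using t one e by (simp add: H_l_distr smult_in smult_mult_left)
qed

lemma inverse_word:
  assumes "u \<in> cox_words n"
  shows "factors (word_factors (rev u)) \<otimes>\<^bsub>H\<^esub> factors (inverse_factors u) = \<one>\<^bsub>H\<^esub>"
    and "factors (inverse_factors u) \<otimes>\<^bsub>H\<^esub> factors (word_factors (rev u)) = \<one>\<^bsub>H\<^esub>"
  using assms
proof (induction u)
  case Nil
  {
    case 1
    show ?case by (simp add: word_factors_def inverse_factors_def)
  next
    case 2
    show ?case by (simp add: word_factors_def inverse_factors_def)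
  }
next
  case (Cons a u)
  let ?R = "factors (word_factors (rev u))" and ?I = "factors (inverse_factors u)"
  let ?t = "T (cox_gen n a)" and ?s = "factor (q_inv, q_inv * (1 - q), a)"
  {
    assume "a # u \<in> cox_words n"
    then have a: "a \<in> {1..n}" and u: "u \<in> cox_words n" by auto
    have in_H: "?R \<in> carrier H" "?I \<in> carrier H" "?t \<in> carrier H" "?s \<in> carrier H"
      using a u by (auto intro!: factors_in letters_ok_word letters_ok_inverse T_gen_in factor_in)
    have R: "factors (word_factors (rev (a # u))) = ?R \<otimes>\<^bsub>H\<^esub> ?t"
    proof -
      have "factors (word_factors (rev u) @ word_factors [a]) = ?R \<otimes>\<^bsub>H\<^esub> factors (word_factors [a])"
        using a u by (intro factors_append letters_ok_word) auto
      also have "factors (word_factors [a]) = ?t"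
        using a in_H(3) by (simp add: word_factors_def factors_Cons factor_gen)
      finally show ?thesis by (simp add: word_factors_def)
    qed
    have I: "factors (inverse_factors (a # u)) = ?s \<otimes>\<^bsub>H\<^esub> ?I"
      by (simp add: inverse_factors_def factors_Cons)
    have "(?R \<otimes>\<^bsub>H\<^esub> ?t) \<otimes>\<^bsub>H\<^esub> (?s \<otimes>\<^bsub>H\<^esub> ?I) = ?R \<otimes>\<^bsub>H\<^esub> ((?t \<otimes>\<^bsub>H\<^esub> ?s) \<otimes>\<^bsub>H\<^esub> ?I)"
      using in_H by (simp add: H_m_assoc)
    then have "(?R \<otimes>\<^bsub>H\<^esub> ?t) \<otimes>\<^bsub>H\<^esub> (?s \<otimes>\<^bsub>H\<^esub> ?I) = \<one>\<^bsub>H\<^esub>"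
      using Cons.IH(1)[OF u] inverse_gen(1)[OF a] in_H by simp
    moreover have "(?s \<otimes>\<^bsub>H\<^esub> ?I) \<otimes>\<^bsub>H\<^esub> (?R \<otimes>\<^bsub>H\<^esub> ?t) = ?s \<otimes>\<^bsub>H\<^esub> ((?I \<otimes>\<^bsub>H\<^esub> ?R) \<otimes>\<^bsub>H\<^esub> ?t)"
      using in_H by (simp add: H_m_assoc)
    then have "(?s \<otimes>\<^bsub>H\<^esub> ?I) \<otimes>\<^bsub>H\<^esub> (?R \<otimes>\<^bsub>H\<^esub> ?t) = \<one>\<^bsub>H\<^esub>"
      using Cons.IH(2)[OF u] inverse_gen(2)[OF a] in_H by simp
    ultimately have "factors (word_factors (rev (a # u))) \<otimes>\<^bsub>H\<^esub> factors (inverse_factors (a # u)) = \<one>\<^bsub>H\<^esub>"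
      "factors (inverse_factors (a # u)) \<otimes>\<^bsub>H\<^esub> factors (word_factors (rev (a # u))) = \<one>\<^bsub>H\<^esub>"
      unfolding R I by simp_all
  }
  then show "a # u \<in> cox_words n \<Longrightarrow>
      factors (word_factors (rev (a # u))) \<otimes>\<^bsub>H\<^esub> factors (inverse_factors (a # u)) = \<one>\<^bsub>H\<^esub>"
    "a # u \<in> cox_words n \<Longrightarrow>
      factors (inverse_factors (a # u)) \<otimes>\<^bsub>H\<^esub> factors (word_factors (rev (a # u))) = \<one>\<^bsub>H\<^esub>"
    by simp_all
qed

abbreviation J :: "'h set" where
  "J \<equiv> TL_ideal n H T"

abbreviation TL :: "(laurent, 'h set) module" where
  "TL \<equiv> TL_algebra n H T"

abbreviation proj :: "'h \<Rightarrow> 'h set" where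
  "proj h \<equiv> J +>\<^bsub>H\<^esub> h"

lemma TL_fields:
  "carrier TL = carrier (H Quot J)" "monoid.mult TL = monoid.mult (H Quot J)" "one TL = one (H Quot J)"
  "zero TL = zero (H Quot J)" "add TL = add (H Quot J)"
  "c \<odot>\<^bsub>TL\<^esub> X = (\<Union>h\<in>X. proj (c \<odot>\<^bsub>H\<^esub> h))"
  by (simp_all add: TL_algebra_def ring.defs module.defs)

lemma TL_inv: "inv\<^bsub>TL\<^esub> X = inv\<^bsub>H Quot J\<^esub> X"
  by (simp add: m_inv_def TL_fields)

lemma TL_finsum: "(\<Oplus>\<^bsub>TL\<^esub>x\<in>A. f x) = (\<Oplus>\<^bsub>H Quot J\<^esub>x\<in>A. f x)"
  by (simp add: finsum_def finprod_def TL_fields)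

lemma proj_hom: "ring_hom_ring H (H Quot J) (\<lambda>h. proj h)"
  by (rule ideal.rcos_ring_hom_ring[OF TL_ideal_ideal])

lemma proj_in: "h \<in> carrier H \<Longrightarrow> proj h \<in> carrier (H Quot J)"
  by (rule ring_hom_closed[OF ring_hom_ring.homh[OF proj_hom]])

lemma TL_ideal_subset: "h \<in> J \<Longrightarrow> h \<in> carrier H"
  using TL_ideal_killed by (auto simp: killed_def)

lemma TL_ideal_smult:
  assumes "h \<in> J"
  shows "c \<odot>\<^bsub>H\<^esub> h \<in> J"
proof -
  have h: "h \<in> carrier H" and one: "\<one>\<^bsub>H\<^esub> \<in> carrier H"
    using TL_ideal_subset[OF assms] ring.ring_simprules(6)[OF ring_H] by auto
  have "c \<odot>\<^bsub>H\<^esub> h = (c \<odot>\<^bsub>H\<^esub> \<one>\<^bsub>H\<^esub>) \<otimes>\<^bsub>H\<^esub> h"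
    using h one by (simp add: smult_mult_left)
  also have "\<dots> \<in> J"
    using ideal.I_l_closed[OF TL_ideal_ideal assms smult_in[OF one]] .
  finally show ?thesis .
qed

lemma mem_proj: "x \<in> proj h \<longleftrightarrow> (\<exists>z\<in>J. x = z \<oplus>\<^bsub>H\<^esub> h)"
  by (auto simp: a_r_coset_def')

lemma proj_self: "h \<in> carrier H \<Longrightarrow> h \<in> proj h"
  using additive_subgroup.zero_closed[OF ideal.axioms(1)[OF TL_ideal_ideal]]
    ring.ring_simprules(8)[OF ring_H, of h] by (force simp: mem_proj)

lemma TL_form_proj_eq:
  assumes "TL_form F" "x \<in> carrier H" "y \<in> carrier H" "proj x = proj y"
  shows "F x = F y"
proof -
  have "x \<in> proj y" using proj_self[OF assms(2)] assms(4) by simp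
  then obtain z where z: "z \<in> J" "x = z \<oplus>\<^bsub>H\<^esub> y" by (auto simp: mem_proj)
  have "linear_form F" "F z = 0" using assms(1) z(1) by (auto simp: TL_form_def)
  then show ?thesis using z TL_ideal_subset[OF z(1)] assms(3) by (simp add: linear_form_add)
qed

lemma proj_add_ideal:
  assumes "z \<in> J" "h \<in> carrier H"
  shows "proj (z \<oplus>\<^bsub>H\<^esub> h) = proj h"
proof -
  have "z \<oplus>\<^bsub>H\<^esub> h \<in> proj h" using assms(1) by (auto simp: mem_proj)
  then show ?thesis by (rule ideal.rcos_eqI[OF TL_ideal_ideal _ assms(2)])
qed

text \<open>The ideal absorbs scalars because these act as multiples of the unit, so the union that
  defines the scalar multiplication of the quotient is a union of equal cosets.\<close>

lemma TL_smult_proj: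
  assumes "h \<in> carrier H"
  shows "c \<odot>\<^bsub>TL\<^esub> proj h = proj (c \<odot>\<^bsub>H\<^esub> h)"
proof -
  have "proj (c \<odot>\<^bsub>H\<^esub> x) = proj (c \<odot>\<^bsub>H\<^esub> h)" if "x \<in> proj h" for x
  proof -
    obtain z where z: "z \<in> J" "x = z \<oplus>\<^bsub>H\<^esub> h" using \<open>x \<in> _\<close> by (auto simp: mem_proj)
    have "c \<odot>\<^bsub>H\<^esub> x = c \<odot>\<^bsub>H\<^esub> z \<oplus>\<^bsub>H\<^esub> c \<odot>\<^bsub>H\<^esub> h"
      unfolding z(2) using TL_ideal_subset[OF z(1)] assms by (rule smult_add_right)
    then show ?thesis using proj_add_ideal[OF TL_ideal_smult[OF z(1)] smult_in[OF assms]] by simp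
  qed
  then show ?thesis unfolding TL_fields(6) using proj_self[OF assms] by blast
qed

lemma TL_finsum_proj:
  assumes "f \<in> A \<rightarrow> carrier H"
  shows "(\<Oplus>\<^bsub>TL\<^esub>x\<in>A. proj (f x)) = proj (\<Oplus>\<^bsub>H\<^esub>x\<in>A. f x)"
  unfolding TL_finsum using ring_hom_ring.hom_finsum[OF proj_hom assms] by (simp add: comp_def)

lemma TL_inv_word:
  assumes "u \<in> cox_words n" "reduced u"
  shows "inv\<^bsub>TL\<^esub> (TL_t n H T (inv\<^bsub>coxA n\<^esub> (cox_elem n u))) = proj (factors (inverse_factors u))"
proof -
  let ?R = "factors (word_factors (rev u))" and ?I = "factors (inverse_factors u)"
  have w: "rev u \<in> cox_words n" using assms(1) by simp
  have in_H: "?R \<in> carrier H" "?I \<in> carrier H"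
    using assms w by (auto intro!: factors_in letters_ok_word letters_ok_inverse)
  note hom = ring_hom_ring.homh[OF proj_hom]
  have "proj ?R \<otimes>\<^bsub>H Quot J\<^esub> proj ?I = \<one>\<^bsub>H Quot J\<^esub>"
    unfolding ring_hom_mult[OF hom in_H, symmetric] inverse_word[OF assms(1)] by (rule ring_hom_one[OF hom])
  moreover have "proj ?I \<otimes>\<^bsub>H Quot J\<^esub> proj ?R = \<one>\<^bsub>H Quot J\<^esub>"
    unfolding ring_hom_mult[OF hom in_H(2,1), symmetric] inverse_word[OF assms(1)] by (rule ring_hom_one[OF hom])
  ultimately have "inv\<^bsub>H Quot J\<^esub> (proj ?R) = proj ?I"
    by (intro monoid.inv_char[OF ring.is_monoid[OF ideal.quotient_is_ring[OF TL_ideal_ideal]]] proj_in in_H)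
  then show ?thesis
    unfolding TL_inv TL_t_def inv_coxA[OF assms(1)] T_reduced[OF w reduced_rev[OF assms]] .
qed

text \<open>Applying a linear form to the equation that defines the polynomials.\<close>

lemma family_linear_form:
  assumes "u \<in> cox_words n" "reduced u" "is_a_family n H T (cox_elem n u) a" "TL_form F"
  shows "F (factors (inverse_factors u)) = qpow (- int (length u)) *
    (\<Sum>y\<in>{y \<in> fully_commutative n. bruhat_le n y (cox_elem n u)}. laurent_of_poly (a y) * F (T y))"
proof -
  let ?Y = "{y \<in> fully_commutative n. bruhat_le n y (cox_elem n u)}"
  let ?l = "qpow (- int (length u))"
  let ?f = "\<lambda>y. laurent_of_poly (a y) \<odot>\<^bsub>H\<^esub> T y"
  let ?S = "\<Oplus>\<^bsub>H\<^esub>y\<in>?Y. ?f y"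
  have sub: "?Y \<subseteq> carrier (coxA n)" by (auto simp: fully_commutative_def)
  have fin: "finite ?Y" by (rule finite_subset[OF sub finite_carrier_coxA])
  have T: "T y \<in> carrier H" if "y \<in> ?Y" for y using that sub T_closed by blast
  then have f: "?f \<in> ?Y \<rightarrow> carrier H" by (auto intro: smult_in)
  have S: "?S \<in> carrier H" by (rule abelian_monoid.finsum_closed[OF abelian_monoid_H f])
  have len: "cox_length (cox_elem n u) = length u"
    using assms by (simp add: cox_length_eq_inv_count)
  have "(\<Oplus>\<^bsub>TL\<^esub>y\<in>?Y. laurent_of_poly (a y) \<odot>\<^bsub>TL\<^esub> TL_t n H T y) = (\<Oplus>\<^bsub>TL\<^esub>y\<in>?Y. proj (?f y))"
  proof -
    have abm: "abelian_monoid (H Quot J)"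
      using ring.is_abelian_group[OF ideal.quotient_is_ring[OF TL_ideal_ideal]]
      by (simp add: abelian_group_def)
    show ?thesis
      unfolding TL_finsum
      by (rule abelian_monoid.finsum_cong'[OF abm refl])
        (use T f in \<open>auto simp: TL_t_def TL_smult_proj intro!: proj_in smult_in\<close>)
  qed
  also have "\<dots> = proj ?S" by (rule TL_finsum_proj[OF f])
  finally have "proj (factors (inverse_factors u)) = ?l \<odot>\<^bsub>TL\<^esub> proj ?S"
    using assms(3) unfolding is_a_family_def TL_inv_word[OF assms(1,2)] len by simp
  then have "proj (factors (inverse_factors u)) = proj (?l \<odot>\<^bsub>H\<^esub> ?S)"
    unfolding TL_smult_proj[OF S] .
  then have "F (factors (inverse_factors u)) = F (?l \<odot>\<^bsub>H\<^esub> ?S)"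
    using assms(1) S by (intro TL_form_proj_eq[OF assms(4)] factors_in letters_ok_inverse smult_in)
  also have "\<dots> = ?l * F ?S"
    using assms(4) S by (intro linear_form_smult) (auto simp: TL_form_def)
  also have "F ?S = (\<Sum>y\<in>?Y. F (?f y))"
    using assms(4) by (intro linear_form_finsum fin f) (auto simp: TL_form_def)
  also have "\<dots> = (\<Sum>y\<in>?Y. laurent_of_poly (a y) * F (T y))"
    using assms(4) T by (intro sum.cong refl linear_form_smult) (auto simp: TL_form_def)
  finally show ?thesis .
qed

end

section \<open>Integer polynomials inside the Laurent polynomials\<close>

lemma laurent_of_poly_mult: "laurent_of_poly (p * r) = laurent_of_poly p * laurent_of_poly r"
proof -
  have "map_poly of_int (p * r) = (map_poly of_int p * map_poly of_int r :: laurent poly)"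
    by (rule poly_eqI) (simp add: coeff_map_poly coeff_mult)
  then show ?thesis by (simp add: laurent_of_poly_def)
qed

lemma laurent_of_poly_diff: "laurent_of_poly (p - r) = laurent_of_poly p - laurent_of_poly r"
proof -
  have "map_poly of_int (p - r) = (map_poly of_int p - map_poly of_int r :: laurent poly)"
    by (rule poly_eqI) (simp add: coeff_map_poly)
  then show ?thesis by (simp add: laurent_of_poly_def)
qed

lemma laurent_of_poly_1 [simp]: "laurent_of_poly 1 = 1"
  by (simp add: laurent_of_poly_def)

lemma laurent_of_poly_X [simp]: "laurent_of_poly [:0, 1:] = q"
  by (simp add: laurent_of_poly_def map_poly_pCons)

lemma laurent_of_poly_power: "laurent_of_poly (p ^ m) = laurent_of_poly p ^ m"
  by (induction m) (simp_all add: laurent_of_poly_mult)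

lemma laurent_of_poly_minus: "laurent_of_poly (- p) = - laurent_of_poly p"
  using laurent_of_poly_diff[of 0 p] by (simp add: laurent_of_poly_def)

lemma q_power: "q ^ m = qpow (int m)"
  by (induction m) (simp_all add: qpow_add)

lemma q_inv_power: "q_inv ^ m = qpow (- int m)"
  by (induction m) (simp_all add: qpow_add)

text \<open>The index is doubled because exponents count powers of \<open>q\<^sup>1\<^sup>/\<^sup>2\<close>.\<close>

lemma lookup_laurent_of_poly: "Poly_Mapping.lookup (laurent_of_poly p) (2 * int m) = poly.coeff p m"
proof -
  have "laurent_of_poly p = (\<Sum>k\<le>degree (map_poly of_int p :: laurent poly). of_int (poly.coeff p k) * q ^ k)"
    by (simp add: laurent_of_poly_def poly_altdef coeff_map_poly)
  also have "\<dots> = (\<Sum>k\<le>degree (map_poly of_int p :: laurent poly). Poly_Mapping.single (2 * int k) (poly.coeff p k))"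
  proof (intro sum.cong refl)
    fix k
    have "(of_int (poly.coeff p k) :: laurent) = Poly_Mapping.single 0 (poly.coeff p k)"
      by (subst single_of_int[symmetric]) simp
    then show "of_int (poly.coeff p k) * q ^ k = Poly_Mapping.single (2 * int k) (poly.coeff p k)"
      unfolding q_power by (simp add: qpow_def mult_single)
  qed
  finally have "Poly_Mapping.lookup (laurent_of_poly p) (2 * int m) =
      (\<Sum>k\<le>degree (map_poly of_int p :: laurent poly). if k = m then poly.coeff p m else 0)"
    by (auto simp: lookup_sum lookup_single when_def intro!: sum.cong)
  moreover have "poly.coeff p m = 0" if "\<not> m \<le> degree (map_poly of_int p :: laurent poly)"
  proof -
    have "poly.coeff (map_poly of_int p :: laurent poly) m = 0" using that by (intro coeff_eq_0) simp
    then show ?thesis by (simp add: coeff_map_poly)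
  qed
  ultimately show ?thesis by (auto simp: sum.delta)
qed

lemma laurent_of_poly_inject: "laurent_of_poly p = laurent_of_poly r \<Longrightarrow> p = r"
  by (metis lookup_laurent_of_poly poly_eqI)

section \<open>The coefficient\<close>

lemma subseq_distinct_filter:
  assumes "subseq xs ys" "distinct ys"
  shows "xs = filter (\<lambda>a. a \<in> set xs) ys"
  using assms
proof (induction rule: list_emb.induct)
  case (list_emb_Cons xs ys y)
  then have "y \<notin> set xs" by (auto dest: list_emb_set)
  then show ?case using list_emb_Cons by simp
next
  case (list_emb_Cons2 x y xs ys)
  then have "filter (\<lambda>a. a \<in> set (x # xs)) ys = filter (\<lambda>a. a \<in> set xs) ys"
    by (intro filter_cong) auto
  then show ?case using list_emb_Cons2 by simp
qed simp

context hecke_algebra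
begin

text \<open>The letters outside \<open>A\<close> become factors \<open>0 T\<^sub>a + 1\<close>, so that all subwords of a run have the
  same letters and differ in the coefficients only.\<close>

definition subword_run :: "nat set \<Rightarrow> nat \<Rightarrow> nat \<Rightarrow> (laurent \<times> laurent \<times> nat) list" where
  "subword_run A l m = run_factors (\<lambda>a. if a \<in> A then 1 else 0) (\<lambda>a. if a \<in> A then 0 else 1) l m"

lemma factor_skip: "a \<in> {1..n} \<Longrightarrow> factor (0, 1, a) = \<one>\<^bsub>H\<^esub>"
  unfolding factor_def using ring.ring_simprules(6,8)[OF ring_H] T_gen_in
  by (simp add: smult_0 smult_1)

lemma factors_filter:
  assumes "u \<in> cox_words n"
  shows "factors (map (\<lambda>a. (if a \<in> A then 1 else 0, if a \<in> A then 0 else 1, a)) u) =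
    factors (word_factors (filter (\<lambda>a. a \<in> A) u))"
  using assms
proof (induction u)
  case (Cons a u)
  then have "factors (word_factors (filter (\<lambda>a. a \<in> A) u)) \<in> carrier H"
    by (intro factors_in letters_ok_word) (auto simp: cox_words_def)
  then show ?case using Cons
    by (simp add: factors_Cons word_factors_def factor_skip)
qed (simp add: word_factors_def)

lemma T_subword:
  assumes "subseq A [i..<m]" "subseq B [l..<m']" "A @ B \<in> cox_words n" "reduced (A @ B)"
    and "[i..<m] @ [l..<m'] \<in> cox_words n"
  shows "T (cox_elem n (A @ B)) = factors (subword_run (set A) i m @ subword_run (set B) l m')"
proof -
  have run: "factors (subword_run (set C) b c) = factors (word_factors C)"
    if "subseq C [b..<c]" "[b..<c] \<in> cox_words n" for C b c
    using factors_filter[OF that(2), of "set C"] subseq_distinct_filter[OF that(1)]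
    by (simp add: subword_run_def run_factors_def)
  have ok: "letters_ok (subword_run (set C) b c)" if "[b..<c] \<in> cox_words n" for C b c
    using that by (auto simp: subword_run_def run_factors_def letters_ok_def cox_words_def)
  have "T (cox_elem n (A @ B)) = factors (word_factors A @ word_factors B)"
    unfolding T_reduced[OF assms(3,4)] by (simp add: word_factors_def)
  also have "\<dots> = factors (word_factors A) \<otimes>\<^bsub>H\<^esub> factors (word_factors B)"
    using assms(3) by (intro factors_append letters_ok_word) auto
  also have "\<dots> = factors (subword_run (set A) i m) \<otimes>\<^bsub>H\<^esub> factors (subword_run (set B) l m')"
    using run assms by simp
  also have "\<dots> = factors (subword_run (set A) i m @ subword_run (set B) l m')"
    using ok assms(5) by (intro factors_append[symmetric]) auto
  finally show ?thesis .
qed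

end

theorem proposition2p8:
  fixes n i k j :: nat
    and H :: "(laurent, 'h) module"
    and T :: "nat list set \<Rightarrow> 'h"
    and w x :: "nat list set"
    and a :: "nat list set \<Rightarrow> int poly"
  assumes "n \<ge> 1"
    and "i \<in> {2..n}"
    and "k \<in> {1..n - i}"
    and "j \<in> {1..i - 1}"
    and "hecke_algebra n H T"
    and "reduced_expression n ([i..<i + k + 1] @ [i - j..<i + k]) w"
    and "reduced_expression n [i..<i + k + 1] x"
    and "is_a_family n H T w a"
  shows "a x = (- [:0, 1:]) ^ k * (1 - [:0, 1:]) ^ j"
proof -
  interpret hecke_algebra n H T by (rule assms(5))
  define l where "l = i - j"
  define m where "m = i + k"
  have lim: "1 \<le> l" "l \<le> i" "i \<le> m" "m \<le> n" "j = i - l" "k = m - i"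
    using assms(2-4) by (auto simp: l_def m_def)
  have size: "Suc m - i = Suc k" "i - l = j" "m - i = k" using lim by simp_all
  let ?X = "[i..<Suc m]" and ?B = "[l..<m]"
  have w: "?X @ ?B \<in> cox_words n" "w = cox_elem n (?X @ ?B)" "reduced (?X @ ?B)"
    and x: "?X \<in> cox_words n" "x = cox_elem n ?X" "reduced ?X"
    using assms(6,7) by (simp_all add: reduced_expression_iff l_def m_def)
  obtain F where F: "TL_form F" and F_run: "\<And>\<alpha> \<beta> \<alpha>' \<beta>'.
    F (factors (run_factors \<alpha> \<beta> i (Suc m) @ run_factors \<alpha>' \<beta>' l m)) =
      (\<Prod>b\<in>{i..<Suc m}. - \<alpha> b) * (\<Prod>b\<in>{l..<i}. \<beta>' b) * (\<Prod>b\<in>{i..<m}. \<beta>' b - \<alpha>' b)"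
    using two_run_form[OF lim(1-4)] by blast
  let ?Y = "{y \<in> fully_commutative n. bruhat_le n y (cox_elem n (?X @ ?B))}"
  have F_sub: "F (T (cox_elem n (A @ B))) = (\<Prod>b\<in>{i..<Suc m}. - (if b \<in> set A then 1 else 0)) *
      (\<Prod>b\<in>{l..<i}. if b \<in> set B then 0 else 1) * (\<Prod>b\<in>{i..<m}. if b \<in> set B then - 1 else 1)"
    if "subseq A ?X" "subseq B ?B" "A @ B \<in> cox_words n" "reduced (A @ B)" for A B
  proof -
    have "(if b \<in> set B then 0 else 1) - (if b \<in> set B then 1 else 0) =
        (if b \<in> set B then - 1 else 1 :: laurent)" for b by simp
    then show ?thesis
      unfolding T_subword[OF that w(1)] subword_run_def F_run by simp
  qed
  have F_x: "F (T x) = (- 1) ^ Suc k"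
  proof -
    have "(\<Prod>b\<in>{i..<Suc m}. - (if b \<in> set ?X then 1 else 0)) = (\<Prod>b\<in>{i..<Suc m}. - 1 :: laurent)"
      by (intro prod.cong) auto
    also have "\<dots> = (- 1) ^ Suc k" by (simp only: prod_constant card_atLeastLessThan size)
    finally have "F (T (cox_elem n (?X @ []))) = (- 1) ^ Suc k *
        (\<Prod>b\<in>{l..<i}. if b \<in> set [] then 0 else 1) * (\<Prod>b\<in>{i..<m}. if b \<in> set [] then - 1 else 1)"
      using F_sub[of ?X "[]"] x(1,3) by (simp only: append_Nil2 list_emb_Nil subseq_order.refl simp_thms)
    then show ?thesis by (simp only: x(2) append_Nil2 list.set empty_iff if_False prod.neutral_const mult_1_right)
  qed
  have F_other: "F (T y) = 0" if y: "y \<in> ?Y" "y \<noteq> x" for y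
  proof (rule ccontr)
    assume nonzero: "F (T y) \<noteq> 0"
    obtain v where v: "subseq v (?X @ ?B)" "v \<in> cox_words n" "y = cox_elem n v" "reduced v"
      using bruhat_le_reduced_subword[OF w(1)] y(1) by blast
    obtain A B where AB: "v = A @ B" "subseq A ?X" "subseq B ?B"
      using subseq_appendE[OF v(1)] by blast
    have "F (T (cox_elem n (A @ B))) \<noteq> 0" using nonzero v(3) AB(1) by simp
    moreover have "F (T (cox_elem n (A @ B))) = 0" if "b \<in> {i..<Suc m}" "b \<notin> set A" for b
    proof -
      have "(\<Prod>b\<in>{i..<Suc m}. - (if b \<in> set A then 1 else 0)) = (0 :: laurent)"
        by (rule prod_zero) (use that in auto)
      then show ?thesis using F_sub[OF AB(2,3) v(2,4)[unfolded AB(1)]] by (simp only: mult_zero_left)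
    qed
    moreover have "F (T (cox_elem n (A @ B))) = 0" if "b \<in> {l..<i}" "b \<in> set B" for b
    proof -
      have "(\<Prod>b\<in>{l..<i}. if b \<in> set B then 0 else 1) = (0 :: laurent)"
        by (rule prod_zero) (use that in auto)
      then show ?thesis using F_sub[OF AB(2,3) v(2,4)[unfolded AB(1)]]
        by (simp only: mult_zero_left mult_zero_right)
    qed
    ultimately have A: "\<forall>b\<in>{i..<Suc m}. b \<in> set A" and B: "\<forall>b\<in>{l..<i}. b \<notin> set B" by blast+
    have "A = filter (\<lambda>a. a \<in> set A) ?X" by (rule subseq_distinct_filter[OF AB(2)]) simp
    also have "\<dots> = ?X" using A by (subst filter_id_conv) auto
    finally have A: "A = ?X" .
    show False
    proof (cases B)
      case Nil
      then show False using y(2) v(3) AB(1) A x(2) by simp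
    next
      case (Cons b B')
      have "b \<in> set ?B" using AB(3) Cons by (auto dest: list_emb_set)
      then have "i \<le> b" "Suc b < Suc m" using B Cons by (auto simp: not_less)
      then have "cox_elem n (?X @ b # B') \<notin> fully_commutative n"
        using v(2,4) AB(1) A Cons by (intro fully_commutative_run_then_word) simp_all
      then show False using y(1) v(3) AB(1) A Cons by simp
    qed
  qed
  have xY: "x \<in> ?Y"
    using ascending_run_fully_commutative[OF x(1,3)] prefix_bruhat_le[OF w(1,3)] lim x(2) by simp
  have finY: "finite ?Y"
    by (rule finite_subset[OF _ finite_carrier_coxA]) (auto simp: fully_commutative_def)
  \<comment> \<open>The length of \<open>w\<close>, split as the lengths of the two runs.\<close>
  let ?N = "Suc k + (j + k)"
  have len: "length (?X @ ?B) = ?N" using lim by simp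
  have "F (factors (inverse_factors (?X @ ?B))) =
      qpow (- int ?N) * (\<Sum>y\<in>?Y. laurent_of_poly (a y) * F (T y))"
    using family_linear_form[OF w(1,3) _ F, of a] assms(8) w(2) len by metis
  also have "(\<Sum>y\<in>?Y. laurent_of_poly (a y) * F (T y)) = laurent_of_poly (a x) * F (T x)"
    using F_other by (subst sum.remove[OF finY xY]) simp
  finally have lhs: "F (factors (inverse_factors (?X @ ?B))) =
      q_inv ^ ?N * (laurent_of_poly (a x) * (- 1) ^ Suc k)"
    unfolding F_x q_inv_power .
  \<comment> \<open>The same value, computed from the inverse itself.\<close>
  have "F (factors (inverse_factors (?X @ ?B))) =
      (\<Prod>b\<in>{i..<Suc m}. - q_inv) * (\<Prod>b\<in>{l..<i}. q_inv * (1 - q)) * (\<Prod>b\<in>{i..<m}. q_inv * (1 - q) - q_inv)"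
    using F_run[of "\<lambda>b. q_inv" "\<lambda>b. q_inv * (1 - q)" "\<lambda>b. q_inv" "\<lambda>b. q_inv * (1 - q)"]
    by (simp only: inverse_factors_def run_factors_def map_append)
  also have "\<dots> = (- q_inv) ^ Suc k * (q_inv * (1 - q)) ^ j * (q_inv * (1 - q) - q_inv) ^ k"
    by (simp only: prod_constant card_atLeastLessThan size)
  also have "q_inv * (1 - q) - q_inv = q_inv * (- q)" by (simp only: right_diff_distrib mult_1_right mult_minus_right diff_diff_eq2) simp
  also have "- q_inv = q_inv * (- 1)" by simp
  also have "(q_inv * (- 1)) ^ Suc k * (q_inv * (1 - q)) ^ j * (q_inv * (- q)) ^ k =
      q_inv ^ ?N * ((- q) ^ k * (1 - q) ^ j * (- 1) ^ Suc k)"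
    by (simp only: power_mult_distrib power_add mult_ac)
  finally have "q_inv ^ ?N * (laurent_of_poly (a x) * (- 1) ^ Suc k) =
      q_inv ^ ?N * ((- q) ^ k * (1 - q) ^ j * (- 1) ^ Suc k)"
    unfolding lhs .
  then have "q ^ ?N * (q_inv ^ ?N * (laurent_of_poly (a x) * (- 1) ^ Suc k)) * (- 1) ^ Suc k =
      q ^ ?N * (q_inv ^ ?N * ((- q) ^ k * (1 - q) ^ j * (- 1) ^ Suc k)) * (- 1) ^ Suc k"
    by (simp only:)
  then have "(q ^ ?N * q_inv ^ ?N) * (laurent_of_poly (a x) * ((- 1) ^ Suc k * (- 1) ^ Suc k)) =
      (q ^ ?N * q_inv ^ ?N) * ((- q) ^ k * (1 - q) ^ j * ((- 1) ^ Suc k * (- 1) ^ Suc k))"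
    by (simp only: mult_ac)
  moreover have "q ^ ?N * q_inv ^ ?N = 1" by (simp only: power_mult_distrib[symmetric] q_inv power_one)
  moreover have "(- 1 :: laurent) ^ Suc k * (- 1) ^ Suc k = 1" by (simp only: power_mult_distrib[symmetric]) simp
  ultimately have "laurent_of_poly (a x) = (- q) ^ k * (1 - q) ^ j" by (simp only: mult_1_left mult_1_right)
  also have "\<dots> = laurent_of_poly ((- [:0, 1:]) ^ k * (1 - [:0, 1:]) ^ j)"
    by (simp add: laurent_of_poly_mult laurent_of_poly_power laurent_of_poly_minus laurent_of_poly_diff del: minus_pCons)
  finally show ?thesis by (rule laurent_of_poly_inject)
qed

end
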